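(* Let $\varphi\in\mathbb C$ with $|\varphi|=1$ and let $f\in\mathcal L(\mathbb T)$. For any $\varepsilon>0$ there exist $P_\varphi,Q_\varphi\in\mathcal C_\varphi$ (and $n\times n$ matrices $R_\varepsilon,\tilde R_\varepsilon$) such that $$\|T_n(f)-P_\varphi-R_\varepsilon\|_C\le\varepsilon\|T_n(f)\|_C=O(\varepsilon),$$ $$\|T_n(\mathrm{Re}\,f)-Q_\varphi-\tilde R_\varepsilon\|_C\le\varepsilon\|T_n(\mathrm{Re}\,f)\|_C=O(\varepsilon),$$ with $$\mathrm{rank}\,\tilde R_\varepsilon\le 2\,\mathrm{rank}\,R_\varepsilon\le 2\log\varepsilon^{-1}\,(a+b\log\varepsilon^{-1}+c\log n)+d,$$ where the coefficients $a,b,c,d$ depend neither on $n$ nor on $\varepsilon$.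
   Context: $\mathbb T=\{z\in\mathbb C:|z|=1\}$. $\mathcal L(\mathbb T)$ is the subset of $L^\infty(\mathbb T,\mathbb C)$ of all piecewise holomorphic functions with logarithmic singularities, i.e. functions of the form $$f(z)=g(z)+\sum_{k=0}^{p}\sum_{h=0}^{q}\alpha_{kh}\,(z-z_h)^k\log(z-z_h),\quad z\in\mathbb T,$$ with $g$ holomorphic over a set containing $\mathbb T$ and $z_h\in\mathbb T$, $h=0,\dots,q$. $T_n(f)$ is the $n\times n$ Toeplitz matrix with symbol $f$, i.e. with $(i,j)$ entry the Fourier coefficient of $f$ of index $i-j$. $\mathrm{Re}\,f$ is the real part of $f$. $\Pi_\varphi$ is the $n\times n$ matrix with $(\Pi_\varphi)_{i,i+1}=1$ for $1\le i\le n-1$, $(\Pi_\varphi)_{n,1}=\varphi$ and all other entries zero; $\mathcal C_\varphi=\{h(\Pi_\varphi)\mid h\text{ a polynomial}\}$ is the $\varphi$-circulant algebra. $\|A\|_C=\max_{i,j}|a_{ij}|$ is the Chebyshev norm. *)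

theory Defs
  imports "HOL-Complex_Analysis.Complex_Analysis" "Jordan_Normal_Form.DL_Rank"
begin

text \<open>
  Functions on the unit circle are represented by functions on the complex plane, of which only
  the values \<open>f (cis t)\<close> matter, and these only for almost every \<open>t\<close> in \<open>[0, 2\<pi>]\<close>.
\<close>

definition Linf_circle :: "(complex \<Rightarrow> complex) set" where
  "Linf_circle =
     {f. (\<lambda>t. f (cis t)) \<in> borel_measurable (lebesgue_on {0..2*pi}) \<and>
         (\<exists>B. AE t in lebesgue_on {0..2*pi}. norm (f (cis t)) \<le> B)}"

text \<open>
  The determination of the complex logarithm cut along the ray of argument \<open>\<theta> + \<pi>\<close>, with
  imaginary part in \<open>(\<theta> - \<pi>, \<theta> + \<pi>]\<close>. The value \<open>\<theta> = 0\<close> gives the principal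
  logarithm \<open>Ln\<close>.
\<close>

definition log_branch :: "real \<Rightarrow> complex \<Rightarrow> complex" where
  "log_branch \<theta> w = Ln (w * cis (- \<theta>)) + \<i> * of_real \<theta>"

text \<open>
  Piecewise holomorphic functions with logarithmic singularities. Each logarithm
  \<open>log (z - \<zeta> h)\<close> may be any of the above determinations: a single-valued logarithm whose
  argument moves around its zero needs a cut, and depending on the direction of the cut it also
  jumps at a second point of the circle (as the principal one does in general), or is continuous on
  the circle without \<open>\<zeta> h\<close>. The terms with \<open>k = 0\<close> are unbounded, so that
  membership in \<open>Linf_circle\<close> restricts the coefficients \<open>\<alpha> 0 h\<close>.
\<close>

definition log_sing_circle :: "(complex \<Rightarrow> complex) set" where
  "log_sing_circle =
     {f \<in> Linf_circle.
        \<exists>g U (p::nat) (q::nat) (\<alpha> :: nat \<Rightarrow> nat \<Rightarrow> complex) (\<zeta> :: nat \<Rightarrow> complex) (\<theta> :: nat \<Rightarrow> real).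
          open U \<and> sphere 0 1 \<subseteq> U \<and> g holomorphic_on U \<and>
          (\<forall>h\<le>q. \<zeta> h \<in> sphere 0 1) \<and>
          (AE t in lebesgue_on {0..2*pi}.
             f (cis t) = g (cis t) +
               (\<Sum>k\<le>p. \<Sum>h\<le>q. \<alpha> k h * (cis t - \<zeta> h) ^ k * log_branch (\<theta> h) (cis t - \<zeta> h)))}"

definition fourier_coeff :: "(complex \<Rightarrow> complex) \<Rightarrow> int \<Rightarrow> complex" where
  "fourier_coeff f k =
     (LINT t|lebesgue_on {0..2*pi}. f (cis t) * cis (- (of_int k * t))) / (2 * of_real pi)"

definition toeplitz :: "nat \<Rightarrow> (complex \<Rightarrow> complex) \<Rightarrow> complex mat" where
  "toeplitz n f = Matrix.mat n n (\<lambda>(i, j). fourier_coeff f (int i - int j))"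

text \<open>Matrix indices start at \<open>0\<close>. For \<open>n = 1\<close> the matrix is \<open>(\<phi>)\<close>.\<close>

definition phi_shift :: "nat \<Rightarrow> complex \<Rightarrow> complex mat" where
  "phi_shift n \<phi> = Matrix.mat n n
     (\<lambda>(i, j). if j = i + 1 then 1 else if i = n - 1 \<and> j = 0 then \<phi> else 0)"

definition poly_mat :: "complex poly \<Rightarrow> complex mat \<Rightarrow> complex mat" where
  "poly_mat p A = Matrix.mat (dim_row A) (dim_row A)
     (\<lambda>(i, j). \<Sum>k\<le>degree p. Polynomial.coeff p k * (A ^\<^sub>m k) $$ (i, j))"

definition phi_circulants :: "nat \<Rightarrow> complex \<Rightarrow> complex mat set" where
  "phi_circulants n \<phi> = {poly_mat p (phi_shift n \<phi>) | p. True}"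

text \<open>Meaningful for matrices with at least one entry.\<close>

definition chebyshev_norm :: "complex mat \<Rightarrow> real" where
  "chebyshev_norm A = Max (norm ` elements_mat A)"

end

theory Submission
  imports Defs "HOL-Real_Asymp.Real_Asymp"
begin

text \<open>
  The strictly lower triangular Toeplitz matrix with entries \<open>r ^ (i - j)\<close>, where \<open>\<bar>r\<bar> < 1\<close>, is the sum
  of a \<open>\<phi>\<close>-circulant and of the rank one matrix \<open>\<beta> r ^ (n + i - j)\<close>; likewise above the diagonal.
  Hence, if the Fourier coefficients \<open>a m\<close> and \<open>a (- m)\<close> are, uniformly in \<open>m \<ge> 1\<close> and up to \<open>\<eta>\<close>, sums of
  \<open>S\<close> exponentials, then every \<open>T\<^sub>n(f)\<close> is a \<open>\<phi>\<close>-circulant plus a matrix of rank at most \<open>2 S\<close>, up to \<open>\<eta>\<close>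
  in each entry. The approximation holds for all \<open>m\<close> at once, so that \<open>n\<close> does not enter the bound
  and one can take \<open>a = c = 0\<close>.

  The sequences for which \<open>S = O(log\<^sup>2 (1 / \<eta>))\<close> exponentials suffice are closed under linear combinations,
  shifts in both directions and multiplication by \<open>\<lambda> ^ m\<close> with \<open>\<bar>\<lambda>\<bar> = 1\<close>. They contain the
  exponentially decaying ones and, by discretising \<open>1 / m = \<integral> exp (- m t) dt\<close> on dyadic blocks of \<open>t\<close>,
  the sequence \<open>1 / m\<close>. The Fourier coefficients of a holomorphic function decay exponentially; those of
  the logarithm of the chord, of \<open>t\<close> and of steps are combinations of \<open>\<lambda> ^ m / m\<close>; and multiplication by
  \<open>z - \<zeta>\<close> shifts coefficients.

  The symmetric statement for \<open>Re f\<close> follows by taking Hermitian parts. The error for \<open>\<epsilon>\<close> relative to the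
  norms is obtained from an absolute one since the nonzero values among \<open>\<parallel>T\<^sub>n(f)\<parallel>\<^sub>C\<close> and
  \<open>\<parallel>T\<^sub>n(Re f)\<parallel>\<^sub>C\<close> are bounded below.
\<close>

section \<open>Rank of matrices given by sums of outer products\<close>


lemma rank_sum_outer_le:
  fixes f g :: "'s \<Rightarrow> nat \<Rightarrow> complex"
  assumes "finite S"
  shows "vec_space.rank n (Matrix.mat n n (\<lambda>(i, j). \<Sum>s\<in>S. f s i * g s j)) \<le> card S"
  using assms
proof induction
  case empty
  have "Matrix.mat n n (\<lambda>(i, j). \<Sum>s\<in>{}. f s i * g s j) = 0\<^sub>m n n" by auto
  then show ?case using vec_space.rank_0I by (metis card.empty le_refl)
next
  case (insert x S)
  let ?A = "Matrix.mat n n (\<lambda>(i, j). f x i * g x j)"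
  let ?B = "Matrix.mat n n (\<lambda>(i, j). \<Sum>s\<in>S. f s i * g s j)"
  have "Matrix.mat n n (\<lambda>(i, j). \<Sum>s\<in>insert x S. f s i * g s j) = ?A + ?B"
    using insert by auto
  moreover have "vec_space.rank n (?A + ?B) \<le> vec_space.rank n ?A + vec_space.rank n ?B"
    by (rule vec_space.rank_subadditive) auto
  moreover have "vec_space.rank n ?A \<le> 1"
    by (rule vec_space.rank_le_1_product_entries[where f = "f x" and g = "g x"]) auto
  ultimately show ?case using insert by simp
qed

text \<open>A maximal linearly independent set \<open>S\<close> of columns spans all columns and has
  as many elements as the rank. The entries of its vectors and the coordinates of each column along
  them are the two factors.\<close>

lemma rank_factorization:
  fixes A :: "complex mat"
  assumes A: "A \<in> carrier_mat n n"
  obtains S :: "complex vec set" and f g :: "complex vec \<Rightarrow> nat \<Rightarrow> complex" where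
    "finite S" "card S = vec_space.rank n A"
    "\<And>i j. i < n \<Longrightarrow> j < n \<Longrightarrow> A $$ (i, j) = (\<Sum>v\<in>S. f v i * g v j)"
proof -
  interpret vec_space "TYPE(complex)" n .
  let ?C = "set (cols A)"
  have C: "?C \<subseteq> carrier_vec n" using A cols_dim by blast
  obtain S where S: "maximal S (\<lambda>T. T \<subseteq> ?C \<and> lin_indpt T)" "finite S"
    using maximal_exists_superset[of ?C "(\<lambda>T. T \<subseteq> ?C \<and> lin_indpt T)" "{}"]
    by (meson List.finite_set empty_subsetI finite_lin_indpt2 rev_finite_subset empty_iff)
  have SC: "S \<subseteq> ?C" and li: "lin_indpt S" using S(1) by (auto simp: maximal_def)
  have "?C \<subseteq> span S"
  proof
    fix v assume v: "v \<in> ?C"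
    show "v \<in> span S"
    proof (rule ccontr)
      assume n: "v \<notin> span S"
      have SV: "S \<subseteq> carrier_vec n" using SC C by blast
      then have "v \<notin> S" using n span_mem by blast
      moreover have "lin_indpt (S \<union> {v})"
        using lin_dep_iff_in_span[of S v] SV li n v C \<open>v \<notin> S\<close> by (metis subsetD)
      ultimately show False using S(1) v SC unfolding maximal_def by blast
    qed
  qed
  have "\<exists>a. col A j = lincomb a S" if "j < n" for j
  proof -
    have "col A j \<in> ?C" using that A by (metis carrier_matD(2) cols_length cols_nth nth_mem)
    then have "col A j \<in> span S" using \<open>?C \<subseteq> span S\<close> by blast
    then show ?thesis using finite_span[OF S(2)] SC C by auto
  qed
  then obtain a where a: "\<And>j. j < n \<Longrightarrow> col A j = lincomb (a j) S" by metis
  show thesis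
  proof (rule that[of S vec_index "\<lambda>v j. a j v"])
    show "finite S" by fact
    show "card S = rank A" using rank_card_indpt[OF A S(1)] by simp
    fix i j assume ij: "i < n" "j < n"
    have "A $$ (i, j) = vec_index (col A j) i" using A ij by simp
    also have "\<dots> = (\<Sum>v\<in>S. a j v * vec_index v i)" using a[OF ij(2)] lincomb_index[OF ij(1)] SC C by auto
    finally show "A $$ (i, j) = (\<Sum>v\<in>S. vec_index v i * a j v)" by (simp add: mult.commute)
  qed
qed

text \<open>The conjugate transpose of a sum of outer products is a sum of equally many outer
  products, with the factors swapped and conjugated. The disjoint sum \<open>S <+> S\<close> indexes
  both families.\<close>

lemma rank_hermitian_part_le:
  assumes A: "A \<in> carrier_mat n n"
  shows "vec_space.rank n (Matrix.mat n n (\<lambda>(i, j). (A $$ (i, j) + cnj (A $$ (j, i))) / 2))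
    \<le> 2 * vec_space.rank n A"
proof -
  obtain S :: "complex vec set" and u w :: "complex vec \<Rightarrow> nat \<Rightarrow> complex" where S: "finite S" "card S = vec_space.rank n A"
    "\<And>i j. i < n \<Longrightarrow> j < n \<Longrightarrow> A $$ (i, j) = (\<Sum>v\<in>S. u v i * w v j)"
    using rank_factorization[OF A] by blast
  define f where "f = (\<lambda>s i. case s of Inl v \<Rightarrow> u v i / 2 | Inr v \<Rightarrow> cnj (w v i) / 2)"
  define g where "g = (\<lambda>s j. case s of Inl v \<Rightarrow> w v j | Inr v \<Rightarrow> cnj (u v j))"
  have "Matrix.mat n n (\<lambda>(i, j). (A $$ (i, j) + cnj (A $$ (j, i))) / 2) =
     Matrix.mat n n (\<lambda>(i, j). \<Sum>s\<in>S <+> S. f s i * g s j)"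
    by (auto simp: S sum.Plus f_def g_def sum_divide_distrib add_divide_distrib intro!: cong_mat sum.cong)
  also have "vec_space.rank n \<dots> \<le> card (S <+> S)"
    using S by (intro rank_sum_outer_le) auto
  finally show ?thesis using S by (simp add: card_Plus)
qed

section \<open>Triangular Toeplitz matrices of a geometric sequence\<close>

text \<open>For \<open>i, j < n\<close> this is the entry of the sum over \<open>k < n\<close> of
  \<open>p k\<close> times the \<open>k\<close>-th power of \<open>phi_shift n \<phi>\<close>;
  \<open>p\<close> is the first row. Working with entries avoids matrix polynomials in the
  calculations below.\<close>

definition circ :: "nat \<Rightarrow> complex \<Rightarrow> (nat \<Rightarrow> complex) \<Rightarrow> nat \<Rightarrow> nat \<Rightarrow> complex" where
  "circ n \<phi> p i j = (if i \<le> j then p (j - i) else \<phi> * p (n + j - i))"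

text \<open>For \<open>k < n\<close> a shift by \<open>k\<close> wraps around at most once, so that
  \<phi> enters only to the first power.\<close>

lemma phi_shift_pow:
  assumes "k < n"
  shows "phi_shift n \<phi> ^\<^sub>m k = Matrix.mat n n
    (\<lambda>(i, j). if j = i + k then 1 else if j + n = i + k then \<phi> else 0)"
  using assms
proof (induction k)
  case 0
  then show ?case by (auto simp: phi_shift_def)
next
  case (Suc k)
  show ?case
  proof (rule eq_matI)
    fix i j
    assume "i < dim_row (Matrix.mat n n (\<lambda>(i, j). if j = i + Suc k then 1
             else if j + n = i + Suc k then \<phi> else 0))"
      and "j < dim_col (Matrix.mat n n (\<lambda>(i, j). if j = i + Suc k then 1
             else if j + n = i + Suc k then \<phi> else 0))"
    then have ij: "i < n" "j < n" by auto
    let ?A = "\<lambda>l. if j = l + 1 then 1 else if l = n - 1 \<and> j = 0 then \<phi> else 0"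
    have "(phi_shift n \<phi> ^\<^sub>m Suc k) $$ (i, j) =
        (\<Sum>l<n. (if l = i + k then 1 else if l + n = i + k then \<phi> else 0) * ?A l)"
      using Suc ij by (auto simp: scalar_prod_def phi_shift_def lessThan_atLeast0 intro!: sum.cong)
    also have "\<dots> = (\<Sum>l<n. if l = (if i + k < n then i + k else i + k - n)
        then (if i + k < n then 1 else \<phi>) * ?A l else 0)"
      using Suc.prems ij by (intro sum.cong) auto
    also have "\<dots> = (if j = i + Suc k then 1 else if j + n = i + Suc k then \<phi> else 0)"
      using Suc.prems ij by (subst sum.delta) auto
    finally show "(phi_shift n \<phi> ^\<^sub>m Suc k) $$ (i, j) = Matrix.mat n n
        (\<lambda>(i, j). if j = i + Suc k then 1 else if j + n = i + Suc k then \<phi> else 0) $$ (i, j)"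
      using ij by simp
  qed (auto simp: phi_shift_def)
qed

lemma circ_in_phi_circulants: "Matrix.mat n n (\<lambda>(i, j). circ n \<phi> p i j) \<in> phi_circulants n \<phi>"
proof -
  define q where "q = (\<Sum>k<n. Polynomial.monom (p k) k)"
  have q: "Polynomial.coeff q k = (if k < n then p k else 0)" for k
    unfolding q_def coeff_sum by (auto simp: if_distrib cong: if_cong)
  have "Matrix.mat n n (\<lambda>(i, j). circ n \<phi> p i j) = poly_mat q (phi_shift n \<phi>)"
  proof (rule eq_matI)
    fix i j assume "i < dim_row (poly_mat q (phi_shift n \<phi>))" "j < dim_col (poly_mat q (phi_shift n \<phi>))"
    then have ij: "i < n" "j < n" by (auto simp: poly_mat_def phi_shift_def)
    let ?X = "\<lambda>k. (phi_shift n \<phi> ^\<^sub>m k) $$ (i, j)"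
    have "poly_mat q (phi_shift n \<phi>) $$ (i, j) = (\<Sum>k\<le>degree q. Polynomial.coeff q k * ?X k)"
      using ij by (simp add: poly_mat_def phi_shift_def)
    \<comment> \<open>The coefficients vanish outside either range, so passing through the union
      spares any estimate of the degree.\<close>
    also have "\<dots> = (\<Sum>k\<in>{..degree q} \<union> {..<n}. Polynomial.coeff q k * ?X k)"
      by (intro sum.mono_neutral_left) (auto simp: coeff_eq_0)
    also have "\<dots> = (\<Sum>k<n. Polynomial.coeff q k * ?X k)"
      by (intro sum.mono_neutral_right) (auto simp: q)
    also have "\<dots> = (\<Sum>k<n. p k * (if j = i + k then 1 else if j + n = i + k then \<phi> else 0))"
      using ij by (intro sum.cong) (auto simp: q phi_shift_pow)
    also have "\<dots> = (\<Sum>k<n. if k = (if i \<le> j then j - i else n + j - i)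
        then (if i \<le> j then p k else \<phi> * p k) else 0)"
      using ij by (intro sum.cong) auto
    also have "\<dots> = circ n \<phi> p i j"
      using ij by (subst sum.delta) (auto simp: circ_def)
    finally show "Matrix.mat n n (\<lambda>(i, j). circ n \<phi> p i j) $$ (i, j) = poly_mat q (phi_shift n \<phi>) $$ (i, j)"
      using ij by simp
  qed (auto simp: poly_mat_def phi_shift_def)
  then show ?thesis unfolding phi_circulants_def by blast
qed

text \<open>As \<phi> has modulus 1, the shift is unitary and its \<open>n\<close>-th power is
  \<phi> times the identity. The conjugate transpose of its \<open>k\<close>-th power is therefore
  \<open>cnj \<phi>\<close> times the power \<open>n - k\<close>, again a \<phi>-circulant.\<close>

lemma circ_hermitian_part:
  assumes "norm \<phi> = 1" "i < n" "j < n"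
  shows "(circ n \<phi> p i j + cnj (circ n \<phi> p j i)) / 2 =
    circ n \<phi> (\<lambda>d. (p d + (if d = 0 then cnj (p 0) else cnj \<phi> * cnj (p (n - d)))) / 2) i j"
proof -
  have "\<phi> * cnj \<phi> = 1" using assms(1) complex_norm_square[of \<phi>] by simp
  then show ?thesis
    using assms by (cases i j rule: linorder_cases) (auto simp: circ_def algebra_simps)
qed

lemma one_minus_unit_power_neq:
  fixes \<phi> r :: complex
  assumes "norm \<phi> = 1" "norm r < 1" "n \<ge> 1"
  shows "1 - \<phi> * r ^ n \<noteq> 0"
proof
  assume "1 - \<phi> * r ^ n = 0"
  then have "norm (\<phi> * r ^ n) = 1" by (metis norm_one right_minus_eq)
  moreover have "norm r ^ n < 1" using assms by (simp add: power_less_one_iff)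
  ultimately show False using assms by (simp add: norm_mult norm_power)
qed

text \<open>On and above the diagonal the circulant has entries
  \<open>cnj \<phi> * \<alpha> * r ^ (n + i - j)\<close>, which the rank one term cancels. Below it
  the circulant has \<open>\<alpha> * r ^ (i - j)\<close>, and adding the rank one term leaves the
  factor \<open>\<alpha> * (1 - cnj \<phi> * r ^ n) = 1\<close>.\<close>

lemma geometric_lower:
  assumes "norm \<phi> = 1" "norm r < 1" "i < n" "j < n"
  defines "\<alpha> \<equiv> 1 / (1 - cnj \<phi> * r ^ n)"
  shows "circ n \<phi> (\<lambda>d. cnj \<phi> * \<alpha> * r ^ (n - d)) i j + (- cnj \<phi> * \<alpha> * r ^ i) * r ^ (n - j)
    = (if j < i then r ^ (i - j) else 0)"
proof -
  have "\<alpha> * (1 - cnj \<phi> * r ^ n) = 1"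
    unfolding \<alpha>_def using one_minus_unit_power_neq[of "cnj \<phi>" r n] assms by simp
  then have a: "\<alpha> - cnj \<phi> * r ^ n * \<alpha> = 1" by (simp add: algebra_simps)
  have pp: "\<phi> * cnj \<phi> = 1" using assms(1) complex_norm_square[of \<phi>] by simp
  show ?thesis
  proof (cases "j < i")
    case True
    then have "r ^ i * r ^ (n - j) = r ^ n * r ^ (i - j)"
      using assms by (simp add: add.commute flip: power_add)
    moreover have "circ n \<phi> (\<lambda>d. cnj \<phi> * \<alpha> * r ^ (n - d)) i j = (\<phi> * cnj \<phi>) * \<alpha> * r ^ (i - j)"
      using True assms by (simp add: circ_def)
    ultimately have "circ n \<phi> (\<lambda>d. cnj \<phi> * \<alpha> * r ^ (n - d)) i j + (- cnj \<phi> * \<alpha> * r ^ i) * r ^ (n - j)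
       = (\<alpha> - cnj \<phi> * r ^ n * \<alpha>) * r ^ (i - j)"
      unfolding pp by (simp add: algebra_simps)
    then show ?thesis using True unfolding a by simp
  next
    case False
    then have "r ^ i * r ^ (n - j) = r ^ (n - (j - i))"
      using assms by (simp add: add.commute flip: power_add)
    then show ?thesis using False by (simp add: circ_def)
  qed
qed

text \<open>Mirror image of \<open>geometric_lower\<close>. The first row has
  \<open>\<phi> * \<alpha> * r ^ n\<close> instead of \<alpha> at index 0, which makes the diagonal
  cancel as well.\<close>

lemma geometric_upper:
  assumes "norm \<phi> = 1" "norm r < 1" "i < n" "j < n"
  defines "\<alpha> \<equiv> 1 / (1 - \<phi> * r ^ n)"
  shows "circ n \<phi> (\<lambda>d. if d = 0 then \<phi> * \<alpha> * r ^ n else \<alpha> * r ^ d) i j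
      + (- \<phi> * \<alpha> * r ^ (n - i)) * r ^ j = (if i < j then r ^ (j - i) else 0)"
proof -
  have "\<alpha> * (1 - \<phi> * r ^ n) = 1"
    unfolding \<alpha>_def using one_minus_unit_power_neq[of "\<phi>" r n] assms by simp
  then have a: "\<alpha> - \<phi> * r ^ n * \<alpha> = 1" by (simp add: algebra_simps)
  consider "i < j" | "i = j" | "j < i" by linarith
  then show ?thesis
  proof cases
    case 1
    then have "r ^ (n - i) * r ^ j = r ^ n * r ^ (j - i)"
      using assms by (simp add: add.commute flip: power_add)
    then have "circ n \<phi> (\<lambda>d. if d = 0 then \<phi> * \<alpha> * r ^ n else \<alpha> * r ^ d) i j
      + (- \<phi> * \<alpha> * r ^ (n - i)) * r ^ j = (\<alpha> - \<phi> * r ^ n * \<alpha>) * r ^ (j - i)"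
      using 1 by (simp add: circ_def algebra_simps)
    then show ?thesis using 1 unfolding a by simp
  next
    case 2
    then have "r ^ (n - i) * r ^ j = r ^ n" using assms by (simp add: add.commute flip: power_add)
    then show ?thesis using 2 by (simp add: circ_def)
  next
    case 3
    then have "r ^ (n - i) * r ^ j = r ^ (n + j - i)" using assms by (simp add: add.commute flip: power_add)
    then show ?thesis using 3 assms by (simp add: circ_def)
  qed
qed

lemma circ_add: "circ n \<phi> (\<lambda>d. p d + q d) i j = circ n \<phi> p i j + circ n \<phi> q i j"
  by (simp add: circ_def algebra_simps)

lemma circ_sum: "circ n \<phi> (\<lambda>d. \<Sum>s\<in>S. c s * p s d) i j = (\<Sum>s\<in>S. c s * circ n \<phi> (p s) i j)"
  by (simp add: circ_def sum_distrib_left mult_ac)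

text \<open>Each node costs rank one: those in \<open>M\<close> act below the diagonal, those in
  \<open>N\<close> above it. The constant diagonal is a multiple of the identity, hence part of the
  circulant, and costs no rank.\<close>

lemma exponential_sum_circ_plus_low_rank:
  fixes v w :: "complex \<Rightarrow> complex"
  assumes "norm \<phi> = 1" "finite M" "finite N"
    and "\<And>r. r \<in> M \<Longrightarrow> norm r < 1" "\<And>r. r \<in> N \<Longrightarrow> norm r < 1"
  obtains p R where "R \<in> carrier_mat n n" "vec_space.rank n R \<le> card M + card N"
    "\<And>i j. i < n \<Longrightarrow> j < n \<Longrightarrow> circ n \<phi> p i j + R $$ (i, j) =
       (if j < i then \<Sum>r\<in>M. v r * r ^ (i - j) else if i < j then \<Sum>r\<in>N. w r * r ^ (j - i) else a)"
proof -
  define \<alpha> where "\<alpha> = (\<lambda>r. 1 / (1 - cnj \<phi> * r ^ n))"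
  define \<beta> where "\<beta> = (\<lambda>r. 1 / (1 - \<phi> * r ^ n))"
  define p1 where "p1 = (\<lambda>r d. cnj \<phi> * \<alpha> r * r ^ (n - d))"
  define p2 where "p2 = (\<lambda>r d. if d = 0 then \<phi> * \<beta> r * r ^ n else \<beta> r * r ^ d)"
  define p where "p = (\<lambda>d. (\<Sum>r\<in>M. v r * p1 r d) + (\<Sum>r\<in>N. w r * p2 r d) + (if d = 0 then a else 0))"
  define f where "f = (\<lambda>s i. case s of Inl r \<Rightarrow> v r * (- cnj \<phi> * \<alpha> r * r ^ i)
      | Inr r \<Rightarrow> w r * (- \<phi> * \<beta> r * r ^ (n - i)))"
  define g where "g = (\<lambda>s j. case s of Inl r \<Rightarrow> r ^ (n - j) | Inr (r :: complex) \<Rightarrow> r ^ j)"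
  define R where "R = Matrix.mat n n (\<lambda>(i, j). \<Sum>s\<in>M <+> N. f s i * g s j)"
  have "vec_space.rank n R \<le> card (M <+> N)"
    unfolding R_def using assms by (intro rank_sum_outer_le) auto
  then have "vec_space.rank n R \<le> card M + card N" using assms by (simp add: card_Plus)
  moreover have "circ n \<phi> p i j + R $$ (i, j) =
       (if j < i then \<Sum>r\<in>M. v r * r ^ (i - j) else if i < j then \<Sum>r\<in>N. w r * r ^ (j - i) else a)"
    if ij: "i < n" "j < n" for i j
  proof -
    have "circ n \<phi> p i j + R $$ (i, j) =
       (\<Sum>r\<in>M. v r * (circ n \<phi> (p1 r) i j + (- cnj \<phi> * \<alpha> r * r ^ i) * r ^ (n - j)))
       + (\<Sum>r\<in>N. w r * (circ n \<phi> (p2 r) i j + (- \<phi> * \<beta> r * r ^ (n - i)) * r ^ j))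
       + circ n \<phi> (\<lambda>d. if d = 0 then a else 0) i j"
      unfolding p_def circ_add circ_sum R_def using ij assms
      by (simp add: sum.Plus f_def g_def sum.distrib sum_subtractf right_diff_distrib distrib_left mult.assoc sum_negf)
    also have "(\<Sum>r\<in>M. v r * (circ n \<phi> (p1 r) i j + (- cnj \<phi> * \<alpha> r * r ^ i) * r ^ (n - j)))
       = (\<Sum>r\<in>M. v r * (if j < i then r ^ (i - j) else 0))"
      unfolding p1_def \<alpha>_def using assms ij by (intro sum.cong refl) (simp only: geometric_lower)
    also have "(\<Sum>r\<in>N. w r * (circ n \<phi> (p2 r) i j + (- \<phi> * \<beta> r * r ^ (n - i)) * r ^ j))
       = (\<Sum>r\<in>N. w r * (if i < j then r ^ (j - i) else 0))"
      unfolding p2_def \<beta>_def using assms ij by (intro sum.cong refl) (simp only: geometric_upper)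
    finally show ?thesis using ij by (simp add: circ_def)
  qed
  ultimately show thesis using that[of R p] unfolding R_def by simp
qed

section \<open>Approximation of sequences by exponential sums\<close>

text \<open>The nodes are fixed and only the weights are free, so that arbitrarily many
  approximations over the same nodes can be added without increasing their number. Index 0 is exempt
  because the diagonal is handled exactly.\<close>

definition node_approx :: "complex set \<Rightarrow> real \<Rightarrow> (nat \<Rightarrow> complex) \<Rightarrow> bool" where
  "node_approx N \<eta> h \<longleftrightarrow> (\<exists>w. \<forall>m\<ge>1. norm (h m - (\<Sum>r\<in>N. w r * r ^ m)) \<le> \<eta>)"

text \<open>Nodes inside the unit disc keep the denominators of the geometric lemmas nonzero;
  nonzero nodes can be divided by when a shift is undone.\<close>

definition exp_approx :: "real \<Rightarrow> nat \<Rightarrow> (nat \<Rightarrow> complex) \<Rightarrow> bool" where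
  "exp_approx \<eta> S h \<longleftrightarrow> (\<exists>N. finite N \<and> card N \<le> S \<and> (\<forall>r\<in>N. r \<noteq> 0 \<and> norm r < 1) \<and> node_approx N \<eta> h)"

text \<open>The square comes from the sequence \<open>1 / m\<close>, which takes O(log) dyadic
  blocks with O(log) nodes each. The summand 1 keeps the bound away from 0 as \<eta> approaches
  1.\<close>

definition log_approx :: "(nat \<Rightarrow> complex) \<Rightarrow> bool" where
  "log_approx h \<longleftrightarrow> (\<exists>B\<ge>0. \<forall>\<eta>. 0 < \<eta> \<longrightarrow> \<eta> < 1 \<longrightarrow>
     (\<exists>S. real S \<le> B * (1 + ln (1 / \<eta>))\<^sup>2 \<and> exp_approx \<eta> S h))"

section \<open>Approximations over a fixed set of nodes\<close>

lemma node_approx_mono: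
  assumes "node_approx N \<eta> h" "N \<subseteq> N'" "finite N'"
  shows "node_approx N' \<eta> h"
proof -
  obtain w where w: "\<forall>m\<ge>1. norm (h m - (\<Sum>r\<in>N. w r * r ^ m)) \<le> \<eta>"
    using assms by (auto simp: node_approx_def)
  have "(\<Sum>r\<in>N'. (if r \<in> N then w r else 0) * r ^ m) = (\<Sum>r\<in>N. w r * r ^ m)" for m
    using assms by (intro sum.mono_neutral_cong_right) auto
  then show ?thesis using w unfolding node_approx_def
    by (intro exI[of _ "\<lambda>r. if r \<in> N then w r else 0"]) simp
qed

lemma node_approx_power:
  assumes "finite N" "r \<in> N"
  shows "node_approx N 0 (\<lambda>m. r ^ m)"
proof -
  have "(\<Sum>s\<in>N. (if s = r then 1 else 0) * s ^ m) = (\<Sum>s\<in>N. if s = r then s ^ m else 0)" for m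
    by (intro sum.cong) auto
  then show ?thesis using assms unfolding node_approx_def
    by (intro exI[of _ "\<lambda>s. if s = r then 1 else 0"]) (simp add: sum.delta)
qed

lemma node_approx_close:
  assumes "node_approx N \<eta> h" "\<And>m. m \<ge> 1 \<Longrightarrow> norm (h' m - h m) \<le> \<delta>"
  shows "node_approx N (\<eta> + \<delta>) h'"
proof -
  obtain w where w: "\<And>m. m \<ge> 1 \<Longrightarrow> norm (h m - (\<Sum>r\<in>N. w r * r ^ m)) \<le> \<eta>"
    using assms by (auto simp: node_approx_def)
  have "norm (h' m - (\<Sum>r\<in>N. w r * r ^ m)) \<le> \<eta> + \<delta>" if "m \<ge> 1" for m
    using norm_triangle_ineq[of "h' m - h m" "h m - (\<Sum>r\<in>N. w r * r ^ m)"] w[OF that] assms(2)[OF that] by simp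
  then show ?thesis unfolding node_approx_def by blast
qed

lemma node_approx_add:
  assumes "node_approx N \<eta> h" "node_approx N \<eta>' h'"
  shows "node_approx N (\<eta> + \<eta>') (\<lambda>m. h m + h' m)"
proof -
  obtain w w' where w: "\<And>m. m \<ge> 1 \<Longrightarrow> norm (h m - (\<Sum>r\<in>N. w r * r ^ m)) \<le> \<eta>"
    "\<And>m. m \<ge> 1 \<Longrightarrow> norm (h' m - (\<Sum>r\<in>N. w' r * r ^ m)) \<le> \<eta>'"
    using assms by (auto simp: node_approx_def)
  have "norm (h m + h' m - (\<Sum>r\<in>N. (w r + w' r) * r ^ m)) \<le> \<eta> + \<eta>'" if "m \<ge> 1" for m
    using norm_triangle_ineq[of "h m - (\<Sum>r\<in>N. w r * r ^ m)" "h' m - (\<Sum>r\<in>N. w' r * r ^ m)"] w[OF that]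
    by (simp add: algebra_simps sum.distrib)
  then show ?thesis unfolding node_approx_def by (intro exI[of _ "\<lambda>r. w r + w' r"]) simp
qed

lemma node_approx_scale:
  assumes "node_approx N \<eta> h"
  shows "node_approx N (norm c * \<eta>) (\<lambda>m. c * h m)"
proof -
  obtain w where w: "\<And>m. m \<ge> 1 \<Longrightarrow> norm (h m - (\<Sum>r\<in>N. w r * r ^ m)) \<le> \<eta>"
    using assms by (auto simp: node_approx_def)
  have "norm (c * h m - (\<Sum>r\<in>N. (c * w r) * r ^ m)) \<le> norm c * \<eta>" if "m \<ge> 1" for m
  proof -
    have "c * h m - (\<Sum>r\<in>N. (c * w r) * r ^ m) = c * (h m - (\<Sum>r\<in>N. w r * r ^ m))"
      by (simp add: sum_distrib_left algebra_simps)
    then show ?thesis using w[OF that] by (simp add: norm_mult mult_left_mono)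
  qed
  then show ?thesis unfolding node_approx_def by (intro exI[of _ "\<lambda>r. c * w r"]) simp
qed

lemma node_approx_sum:
  assumes "finite I" "\<And>i. i \<in> I \<Longrightarrow> node_approx N (\<eta> i) (h i)"
  shows "node_approx N (\<Sum>i\<in>I. \<eta> i) (\<lambda>m. \<Sum>i\<in>I. h i m)"
  using assms
proof (induction rule: finite_induct)
  case empty
  then show ?case by (auto simp: node_approx_def intro!: exI[of _ "\<lambda>_. 0"])
next
  case (insert x F)
  then show ?case using node_approx_add[of N "\<eta> x" "h x"] by simp
qed

section \<open>Approximations with a bounded number of nodes\<close>

lemma exp_approxI:
  assumes "finite N" "card N \<le> S" "\<And>r. r \<in> N \<Longrightarrow> r \<noteq> 0 \<and> norm r < 1" "node_approx N \<eta> h"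
  shows "exp_approx \<eta> S h"
  using assms unfolding exp_approx_def by blast

lemma exp_approxE:
  assumes "exp_approx \<eta> S h"
  obtains N w where "finite N" "card N \<le> S" "\<And>r. r \<in> N \<Longrightarrow> r \<noteq> 0 \<and> norm r < 1"
    "\<And>m. m \<ge> 1 \<Longrightarrow> norm (h m - (\<Sum>r\<in>N. w r * r ^ m)) \<le> \<eta>"
  using assms unfolding exp_approx_def node_approx_def by blast

lemma exp_approx_mono:
  assumes "exp_approx \<eta> S h" "\<eta> \<le> \<eta>'" "S \<le> S'"
  shows "exp_approx \<eta>' S' h"
proof -
  obtain N w where "finite N" "card N \<le> S" "\<And>r. r \<in> N \<Longrightarrow> r \<noteq> 0 \<and> norm r < 1"
    and w: "\<And>m. m \<ge> 1 \<Longrightarrow> norm (h m - (\<Sum>r\<in>N. w r * r ^ m)) \<le> \<eta>"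
    using exp_approxE[OF assms(1)] by metis
  moreover have "node_approx N \<eta>' h"
    unfolding node_approx_def using w assms(2) by (intro exI[of _ w]) (auto intro: order_trans)
  ultimately show ?thesis using assms(3) by (intro exp_approxI) auto
qed

lemma exp_approx_add:
  assumes "exp_approx \<eta> S h" "exp_approx \<eta>' S' h'"
  shows "exp_approx (\<eta> + \<eta>') (S + S') (\<lambda>m. h m + h' m)"
proof -
  obtain N N' where N: "finite N" "card N \<le> S" "\<forall>r\<in>N. r \<noteq> 0 \<and> norm r < 1" "node_approx N \<eta> h"
    "finite N'" "card N' \<le> S'" "\<forall>r\<in>N'. r \<noteq> 0 \<and> norm r < 1" "node_approx N' \<eta>' h'"
    using assms by (auto simp: exp_approx_def)
  then have "node_approx (N \<union> N') \<eta> h" "node_approx (N \<union> N') \<eta>' h'"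
    by (auto intro: node_approx_mono)
  moreover have "card (N \<union> N') \<le> S + S'" using card_Un_le[of N N'] N by linarith
  ultimately show ?thesis using N by (intro exp_approxI[of "N \<union> N'"] node_approx_add) auto
qed

lemma exp_approx_scale:
  assumes "exp_approx \<eta> S h"
  shows "exp_approx (norm c * \<eta>) S (\<lambda>m. c * h m)"
  using assms node_approx_scale[of _ \<eta> h c] unfolding exp_approx_def by blast

text \<open>Rotate every node by \<open>u\<close>: modulus and number of the nodes are
  unchanged.\<close>

lemma exp_approx_modulate:
  assumes "exp_approx \<eta> S h" "norm u = 1"
  shows "exp_approx \<eta> S (\<lambda>m. u ^ m * h m)"
proof -
  have l: "u \<noteq> 0" using assms by auto
  obtain N w where N: "finite N" "card N \<le> S" "\<And>r. r \<in> N \<Longrightarrow> r \<noteq> 0 \<and> norm r < 1"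
    and w: "\<And>m. m \<ge> 1 \<Longrightarrow> norm (h m - (\<Sum>r\<in>N. w r * r ^ m)) \<le> \<eta>"
    using exp_approxE[OF assms(1)] by metis
  have inj: "inj_on ((*) u) N" using l by (auto simp: inj_on_def)
  have "norm (u ^ m * h m - (\<Sum>r\<in>(*) u ` N. w (r / u) * r ^ m)) \<le> \<eta>" if "m \<ge> 1" for m
  proof -
    have "u ^ m * h m - (\<Sum>r\<in>(*) u ` N. w (r / u) * r ^ m) = u ^ m * (h m - (\<Sum>r\<in>N. w r * r ^ m))"
    proof -
      have "(\<Sum>r\<in>(*) u ` N. w (r / u) * r ^ m) = (\<Sum>r\<in>N. w r * (u * r) ^ m)"
        using l by (subst sum.reindex[OF inj]) auto
      also have "\<dots> = u ^ m * (\<Sum>r\<in>N. w r * r ^ m)"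
        unfolding sum_distrib_left by (intro sum.cong refl) (simp add: power_mult_distrib)
      finally show ?thesis by (simp only: right_diff_distrib)
    qed
    then show ?thesis using w[OF that] assms by (simp add: norm_mult norm_power)
  qed
  then have "node_approx ((*) u ` N) \<eta> (\<lambda>m. u ^ m * h m)"
    unfolding node_approx_def by (intro exI[of _ "\<lambda>r. w (r / u)"]) simp
  moreover have "card ((*) u ` N) \<le> S" using card_image_le[OF N(1), of "(*) u"] N(2) by linarith
  moreover have "r \<noteq> 0 \<and> norm r < 1" if "r \<in> (*) u ` N" for r
    using that N(3) l assms(2) by (auto simp: norm_mult)
  ultimately show ?thesis using N(1) by (intro exp_approxI) auto
qed

lemma exp_approx_cnj:
  assumes "exp_approx \<eta> S h"
  shows "exp_approx \<eta> S (\<lambda>m. cnj (h m))"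
proof -
  obtain N w where N: "finite N" "card N \<le> S" "\<And>r. r \<in> N \<Longrightarrow> r \<noteq> 0 \<and> norm r < 1"
    and w: "\<And>m. m \<ge> 1 \<Longrightarrow> norm (h m - (\<Sum>r\<in>N. w r * r ^ m)) \<le> \<eta>"
    using exp_approxE[OF assms(1)] by metis
  have "norm (cnj (h m) - (\<Sum>r\<in>cnj ` N. cnj (w (cnj r)) * r ^ m)) \<le> \<eta>" if "m \<ge> 1" for m
  proof -
    have "cnj (h m) - (\<Sum>r\<in>cnj ` N. cnj (w (cnj r)) * r ^ m) = cnj (h m - (\<Sum>r\<in>N. w r * r ^ m))"
      by (subst sum.reindex) (auto simp: inj_on_def)
    then show ?thesis using w[OF that] by (metis complex_mod_cnj)
  qed
  then have "node_approx (cnj ` N) \<eta> (\<lambda>m. cnj (h m))"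
    unfolding node_approx_def by (intro exI[of _ "\<lambda>r. cnj (w (cnj r))"]) simp
  moreover have "card (cnj ` N) \<le> S" using card_image_le[OF N(1), of cnj] N(2) by linarith
  ultimately show ?thesis using N by (intro exp_approxI[of "cnj ` N"]) auto
qed

lemma exp_approx_shift:
  assumes "exp_approx \<eta> S h"
  shows "exp_approx \<eta> S (\<lambda>m. h (Suc m))"
proof -
  obtain N w where N: "finite N" "card N \<le> S" "\<And>r. r \<in> N \<Longrightarrow> r \<noteq> 0 \<and> norm r < 1"
    and w: "\<And>m. m \<ge> 1 \<Longrightarrow> norm (h m - (\<Sum>r\<in>N. w r * r ^ m)) \<le> \<eta>"
    using exp_approxE[OF assms(1)] by metis
  have "norm (h (Suc m) - (\<Sum>r\<in>N. (w r * r) * r ^ m)) \<le> \<eta>" for m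
    using w[of "Suc m"] by (simp add: mult.assoc)
  then have "node_approx N \<eta> (\<lambda>m. h (Suc m))"
    unfolding node_approx_def by (intro exI[of _ "\<lambda>r. w r * r"]) simp
  then show ?thesis using N by (intro exp_approxI)
qed

text \<open>The value at \<open>1\<close>, which the shifted sequence does not control, is corrected by one node
  so close to \<open>0\<close> that it hardly affects the later values.\<close>

lemma exp_approx_unshift:
  assumes "exp_approx \<eta> S (\<lambda>m. h (Suc m))" "\<eta> < \<eta>'"
  shows "exp_approx \<eta>' (Suc S) h"
proof -
  obtain N w where N: "finite N" "card N \<le> S" "\<And>r. r \<in> N \<Longrightarrow> r \<noteq> 0 \<and> norm r < 1"
    and w: "\<And>m. m \<ge> 1 \<Longrightarrow> norm (h (Suc m) - (\<Sum>r\<in>N. w r * r ^ m)) \<le> \<eta>"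
    using exp_approxE[OF assms(1)] by metis
  have "norm (h (Suc 1) - (\<Sum>r\<in>N. w r * r ^ 1)) \<le> \<eta>" by (rule w) simp
  then have "\<eta> \<ge> 0" by (meson norm_ge_zero order_trans)
  define c where "c = h 1 - (\<Sum>r\<in>N. w r)"
  \<comment> \<open>A node \<open>t\<close> below this bound lies in the unit disc and satisfies
    \<open>norm c * t \<le> \<eta>' - \<eta>\<close>, which is the error it adds at the later
    indices. It is chosen outside \<open>N\<close> so that its weight does not interfere with an old
    one.\<close>
  define \<epsilon> where "\<epsilon> = min 1 ((\<eta>' - \<eta>) / (norm c + 1))"
  have "\<epsilon> > 0" unfolding \<epsilon>_def using assms(2) by (simp add: add_nonneg_pos)
  then have "infinite (complex_of_real ` {0<..<\<epsilon>})"
    by (subst finite_image_iff) (auto simp: inj_on_def)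
  then obtain t where t: "0 < t" "t < \<epsilon>" "complex_of_real t \<notin> N"
    using N(1) by (metis greaterThanLessThan_iff image_subset_iff rev_finite_subset)
  let ?r0 = "complex_of_real t"
  have ct: "norm c * t \<le> \<eta>' - \<eta>"
  proof -
    have "norm c * t \<le> (norm c + 1) * ((\<eta>' - \<eta>) / (norm c + 1))"
      using t unfolding \<epsilon>_def by (intro mult_mono) auto
    also have "\<dots> = \<eta>' - \<eta>" using add_nonneg_pos[of "norm c" 1] by simp
    finally show ?thesis .
  qed
  \<comment> \<open>Dividing the old weights by their nodes undoes the shift; at index 1 they then
    contribute the sum of \<open>w\<close>, and the new node supplies exactly the missing
    \<open>c\<close>.\<close>
  define v where "v = (\<lambda>r. if r = ?r0 then c / ?r0 else w r / r)"
  have v: "(\<Sum>r\<in>insert ?r0 N. v r * r ^ Suc k) = c * ?r0 ^ k + (\<Sum>r\<in>N. w r * r ^ k)" for k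
  proof -
    have "(\<Sum>r\<in>N. v r * r ^ Suc k) = (\<Sum>r\<in>N. w r * r ^ k)"
      unfolding v_def using t(3) N by (intro sum.cong) auto
    then show ?thesis using t N(1) by (simp add: v_def)
  qed
  have "norm (h m - (\<Sum>r\<in>insert ?r0 N. v r * r ^ m)) \<le> \<eta>'" if m: "m \<ge> 1" for m
  proof (cases "m = 1")
    case True
    then show ?thesis using v[of 0] assms(2) \<open>\<eta> \<ge> 0\<close> by (simp add: c_def)
  next
    case False
    then obtain k where k: "m = Suc k" "k \<ge> 1" using m by (cases m) auto
    have "t ^ k \<le> t ^ 1" using t k unfolding \<epsilon>_def by (intro power_decreasing) auto
    then have "norm c * t ^ k \<le> \<eta>' - \<eta>" using ct mult_left_mono[of "t ^ k" t "norm c"] by simp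
    then have "norm (c * ?r0 ^ k) \<le> \<eta>' - \<eta>"
      using t by (simp add: norm_mult norm_power)
    moreover have "h m - (\<Sum>r\<in>insert ?r0 N. v r * r ^ m) =
       (h (Suc k) - (\<Sum>r\<in>N. w r * r ^ k)) - c * ?r0 ^ k"
      unfolding k v by (simp add: algebra_simps)
    ultimately show ?thesis
      using w[OF k(2)] norm_triangle_ineq4[of "h (Suc k) - (\<Sum>r\<in>N. w r * r ^ k)" "c * ?r0 ^ k"] by simp
  qed
  then have "node_approx (insert ?r0 N) \<eta>' h"
    unfolding node_approx_def by (intro exI[of _ v]) simp
  moreover have "card (insert ?r0 N) \<le> Suc S" using N(1,2) t(3) by simp
  moreover have "r \<noteq> 0 \<and> norm r < 1" if "r \<in> insert ?r0 N" for r
    using that N(3) t unfolding \<epsilon>_def by auto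
  ultimately show ?thesis using N(1) by (intro exp_approxI) auto
qed

lemma exp_approx_unshift_iterate:
  assumes "exp_approx \<eta> S (\<lambda>m. h (m + M))" "\<eta> < \<eta>'"
  shows "exp_approx \<eta>' (S + M) h"
  using assms
proof (induction M arbitrary: h \<eta>')
  case 0
  then show ?case using exp_approx_mono[of \<eta> S h \<eta>' S] by simp
next
  case (Suc M)
  \<comment> \<open>The midpoint leaves a positive gap both for the remaining shifts and for the
    last one.\<close>
  have "exp_approx ((\<eta> + \<eta>') / 2) (S + M) (\<lambda>m. h (Suc m))"
    using Suc.prems by (intro Suc.IH) auto
  then have "exp_approx \<eta>' (Suc (S + M)) h"
    using Suc.prems by (intro exp_approx_unshift[of "(\<eta> + \<eta>') / 2"]) auto
  then show ?case by simp
qed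

section \<open>Sequences with a squared logarithmic number of nodes\<close>

lemma log_approxI:
  assumes "B \<ge> 0" "\<kappa> \<ge> 1"
    and "\<And>\<eta>. 0 < \<eta> \<Longrightarrow> \<eta> < 1 \<Longrightarrow> \<exists>S. real S \<le> B * (1 + ln (\<kappa> / \<eta>))\<^sup>2 \<and> exp_approx \<eta> S h"
  shows "log_approx h"
proof -
  have "\<exists>S. real S \<le> (B * (1 + ln \<kappa>)\<^sup>2) * (1 + ln (1 / \<eta>))\<^sup>2 \<and> exp_approx \<eta> S h"
    if \<eta>: "0 < \<eta>" "\<eta> < 1" for \<eta>
  proof -
    obtain S where S: "real S \<le> B * (1 + ln (\<kappa> / \<eta>))\<^sup>2" "exp_approx \<eta> S h"
      using assms(3)[OF \<eta>] by blast
    have "ln (\<kappa> / \<eta>) = ln \<kappa> + ln (1 / \<eta>)" using \<eta> assms(2) by (simp add: ln_div)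
    moreover have "ln \<kappa> \<ge> 0" "ln (1 / \<eta>) \<ge> 0" using \<eta> assms(2) by auto
    \<comment> \<open>A constant factor in the tolerance thus costs only a constant factor in the
      number of nodes.\<close>
    ultimately have "1 + ln (\<kappa> / \<eta>) \<le> (1 + ln \<kappa>) * (1 + ln (1 / \<eta>))" "0 \<le> 1 + ln (\<kappa> / \<eta>)"
      by (auto simp: algebra_simps)
    then have "(1 + ln (\<kappa> / \<eta>))\<^sup>2 \<le> ((1 + ln \<kappa>) * (1 + ln (1 / \<eta>)))\<^sup>2" by (rule power_mono)
    then have "B * (1 + ln (\<kappa> / \<eta>))\<^sup>2 \<le> B * ((1 + ln \<kappa>) * (1 + ln (1 / \<eta>)))\<^sup>2"
      using assms(1) by (rule mult_left_mono)
    then show ?thesis using S by (intro exI[of _ S]) (simp add: power_mult_distrib mult.assoc)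
  qed
  then show ?thesis using assms unfolding log_approx_def by (intro exI[of _ "B * (1 + ln \<kappa>)\<^sup>2"]) auto
qed

lemma log_approxE:
  assumes "log_approx h"
  obtains B where "B \<ge> 0"
    "\<And>\<eta>. 0 < \<eta> \<Longrightarrow> \<eta> < 1 \<Longrightarrow> \<exists>S. real S \<le> B * (1 + ln (1 / \<eta>))\<^sup>2 \<and> exp_approx \<eta> S h"
  using assms unfolding log_approx_def by blast

lemma log_approx_add:
  assumes "log_approx h" "log_approx h'"
  shows "log_approx (\<lambda>m. h m + h' m)"
proof -
  obtain B B' where B: "B \<ge> 0" "B' \<ge> 0"
    "\<And>\<eta>. 0 < \<eta> \<Longrightarrow> \<eta> < 1 \<Longrightarrow> \<exists>S. real S \<le> B * (1 + ln (1 / \<eta>))\<^sup>2 \<and> exp_approx \<eta> S h"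
    "\<And>\<eta>. 0 < \<eta> \<Longrightarrow> \<eta> < 1 \<Longrightarrow> \<exists>S. real S \<le> B' * (1 + ln (1 / \<eta>))\<^sup>2 \<and> exp_approx \<eta> S h'"
    using assms log_approxE by metis
  show ?thesis
  proof (rule log_approxI[of "B + B'" 2])
    fix \<eta> :: real assume \<eta>: "0 < \<eta>" "\<eta> < 1"
    obtain S where S: "real S \<le> B * (1 + ln (2 / \<eta>))\<^sup>2" "exp_approx (\<eta> / 2) S h"
      using B(3)[of "\<eta> / 2"] \<eta> by auto
    obtain S' where S': "real S' \<le> B' * (1 + ln (2 / \<eta>))\<^sup>2" "exp_approx (\<eta> / 2) S' h'"
      using B(4)[of "\<eta> / 2"] \<eta> by auto
    show "\<exists>S. real S \<le> (B + B') * (1 + ln (2 / \<eta>))\<^sup>2 \<and> exp_approx \<eta> S (\<lambda>m. h m + h' m)"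
      using exp_approx_add[OF S(2) S'(2)] S(1) S'(1)
      by (intro exI[of _ "S + S'"]) (simp add: algebra_simps)
  qed (use B in auto)
qed

lemma log_approx_scale:
  assumes "log_approx h"
  shows "log_approx (\<lambda>m. c * h m)"
proof -
  obtain B where B: "B \<ge> 0"
    "\<And>\<eta>. 0 < \<eta> \<Longrightarrow> \<eta> < 1 \<Longrightarrow> \<exists>S. real S \<le> B * (1 + ln (1 / \<eta>))\<^sup>2 \<and> exp_approx \<eta> S h"
    using assms log_approxE by metis
  let ?k = "norm c + 1"
  have k: "?k \<ge> 1" by simp
  show ?thesis
  proof (rule log_approxI[of B ?k])
    fix \<eta> :: real assume \<eta>: "0 < \<eta>" "\<eta> < 1"
    have "\<eta> < ?k" "0 < ?k" using \<eta> k by linarith+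
    then have "0 < \<eta> / ?k" "\<eta> / ?k < 1" using \<eta> by auto
    then obtain S where S: "real S \<le> B * (1 + ln (1 / (\<eta> / ?k)))\<^sup>2" "exp_approx (\<eta> / ?k) S h"
      using B(2)[of "\<eta> / ?k"] by blast
    have "norm c * \<eta> \<le> ?k * \<eta>" using \<eta> by (intro mult_right_mono) auto
    then have "norm c * (\<eta> / ?k) \<le> \<eta>" using \<open>0 < ?k\<close> by (simp add: pos_divide_le_eq mult.commute)
    then show "\<exists>S. real S \<le> B * (1 + ln (?k / \<eta>))\<^sup>2 \<and> exp_approx \<eta> S (\<lambda>m. c * h m)"
      using exp_approx_scale[OF S(2), of c] S(1) by (intro exI[of _ S]) (auto intro: exp_approx_mono)
  qed (use B in auto)
qed

lemma log_approx_map: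
  assumes "log_approx h" "\<And>\<eta> S. exp_approx \<eta> S h \<Longrightarrow> exp_approx \<eta> S h'"
  shows "log_approx h'"
proof -
  obtain B where B: "B \<ge> 0"
    "\<And>\<eta>. 0 < \<eta> \<Longrightarrow> \<eta> < 1 \<Longrightarrow> \<exists>S. real S \<le> B * (1 + ln (1 / \<eta>))\<^sup>2 \<and> exp_approx \<eta> S h"
    using assms(1) log_approxE by metis
  then show ?thesis using assms(2) by (intro log_approxI[of B 1]) (auto, blast)
qed

lemma log_approx_modulate:
  assumes "log_approx h" "norm u = 1"
  shows "log_approx (\<lambda>m. u ^ m * h m)"
  using assms(1) by (rule log_approx_map) (rule exp_approx_modulate[OF _ assms(2)])

lemma log_approx_cnj:
  assumes "log_approx h"
  shows "log_approx (\<lambda>m. cnj (h m))"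
  using assms by (rule log_approx_map) (rule exp_approx_cnj)

lemma log_approx_shift:
  assumes "log_approx h"
  shows "log_approx (\<lambda>m. h (Suc m))"
  using assms by (rule log_approx_map) (rule exp_approx_shift)

lemma log_approx_unshift:
  assumes "log_approx (\<lambda>m. h (Suc m))"
  shows "log_approx h"
proof -
  obtain B where B: "B \<ge> 0"
    "\<And>\<eta>. 0 < \<eta> \<Longrightarrow> \<eta> < 1 \<Longrightarrow> \<exists>S. real S \<le> B * (1 + ln (1 / \<eta>))\<^sup>2 \<and> exp_approx \<eta> S (\<lambda>m. h (Suc m))"
    using assms log_approxE by metis
  show ?thesis
  proof (rule log_approxI[of "B + 1" 2])
    fix \<eta> :: real assume \<eta>: "0 < \<eta>" "\<eta> < 1"
    obtain S where S: "real S \<le> B * (1 + ln (2 / \<eta>))\<^sup>2" "exp_approx (\<eta> / 2) S (\<lambda>m. h (Suc m))"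
      using B(2)[of "\<eta> / 2"] \<eta> by auto
    have "exp_approx \<eta> (Suc S) h" using S(2) by (rule exp_approx_unshift) (use \<eta> in auto)
    moreover have "1 ^ 2 \<le> (1 + ln (2 / \<eta>))\<^sup>2" using \<eta> by (intro power_mono) auto
    ultimately show "\<exists>S. real S \<le> (B + 1) * (1 + ln (2 / \<eta>))\<^sup>2 \<and> exp_approx \<eta> S h"
      using S(1) by (intro exI[of _ "Suc S"]) (simp add: algebra_simps)
  qed (use B in auto)
qed

lemma log_approx_cong:
  assumes "log_approx h" "\<And>m. m \<ge> 1 \<Longrightarrow> h' m = h m"
  shows "log_approx h'"
  using assms unfolding log_approx_def exp_approx_def node_approx_def by simp

text \<open>From an index \<open>M = O(log (1 / \<eta>))\<close> on, the sequence is below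
  \<open>\<eta> / 2\<close>, so that no node at all is needed there. Undoing the shift by
  \<open>M\<close> costs one node for each of the first values.\<close>

lemma log_approx_exp_decay:
  assumes "0 < \<rho>" "\<rho> < 1" "\<And>m. norm (h m) \<le> C * \<rho> ^ m"
  shows "log_approx h"
proof -
  define C' where "C' = max 1 C"
  have C': "C' \<ge> 1" "norm (h m) \<le> C' * \<rho> ^ m" for m
    using order_trans[OF assms(3)[of m] mult_right_mono[of C C' "\<rho> ^ m"]] assms(1) by (auto simp: C'_def)
  let ?l = "ln (1 / \<rho>)"
  have l: "?l > 0" using assms by simp
  show ?thesis
  proof (rule log_approxI[of "1 + 1 / ?l" "2 * C'"])
    fix \<eta> :: real assume \<eta>: "0 < \<eta>" "\<eta> < 1"
    let ?L = "ln (2 * C' / \<eta>)"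
    have "2 * C' / \<eta> \<ge> 1" using \<eta> C'(1) by (simp add: pos_le_divide_eq)
    then have L: "?L \<ge> 0" by (rule ln_ge_zero)
    define M where "M = nat \<lceil>?L / ?l\<rceil>"
    have "?L / ?l \<ge> 0" using L l by (rule divide_nonneg_pos)
    then have M: "?L / ?l \<le> real M" "real M \<le> ?L / ?l + 1"
      unfolding M_def by linarith+
    have "?L \<le> real M * ?l" using M(1) l by (simp only: pos_divide_le_eq)
    then have "exp ?L \<le> exp (real M * ?l)" by (simp only: exp_le_cancel_iff)
    also have "exp (real M * ?l) = (1 / \<rho>) ^ M" using assms by (simp add: exp_of_nat_mult)
    also have "exp ?L = 2 * C' / \<eta>" using \<eta> C'(1) by (intro exp_ln divide_pos_pos) linarith+
    finally have "2 * C' / \<eta> * \<rho> ^ M \<le> (1 / \<rho>) ^ M * \<rho> ^ M"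
      using assms by (intro mult_right_mono) auto
    also have "\<dots> = 1" using assms by (simp flip: power_mult_distrib)
    finally have CM: "C' * \<rho> ^ M \<le> \<eta> / 2" using \<eta> by (simp add: pos_divide_le_eq)
    have "norm (h (m + M)) \<le> \<eta> / 2" for m
    proof -
      have "\<rho> ^ (m + M) \<le> \<rho> ^ M" using assms by (intro power_decreasing) auto
      then have "C' * \<rho> ^ (m + M) \<le> C' * \<rho> ^ M" using C' by (intro mult_left_mono) auto
      then show ?thesis using CM C'(2)[of "m + M"] by linarith
    qed
    then have "exp_approx (\<eta> / 2) 0 (\<lambda>m. h (m + M))"
      unfolding exp_approx_def node_approx_def by (intro exI[of _ "{}"]) auto
    then have "exp_approx \<eta> (0 + M) h" using \<eta> by (intro exp_approx_unshift_iterate[of "\<eta> / 2"]) auto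
    moreover have "real M \<le> (1 + 1 / ?l) * (1 + ?L)\<^sup>2"
    proof -
      have "real M \<le> (1 + 1 / ?l) * (1 + ?L)"
      proof -
        have "?L / ?l + 1 \<le> (1 + 1 / ?l) + ?L + ?L / ?l" using L l by simp
        also have "\<dots> = (1 + 1 / ?l) * (1 + ?L)" by (simp add: algebra_simps)
        finally show ?thesis using M(2) by linarith
      qed
      also have "\<dots> \<le> (1 + 1 / ?l) * (1 + ?L)\<^sup>2"
        using L l by (intro mult_left_mono self_le_power) auto
      finally show ?thesis .
    qed
    ultimately show "\<exists>S. real S \<le> (1 + 1 / ?l) * (1 + ?L)\<^sup>2 \<and> exp_approx \<eta> S h" by auto
  qed (use l C' in auto)
qed

section \<open>Exponential sums for the reciprocals\<close>

text \<open>The quotient of consecutive coefficients is \<open>(s - k) / (k + 1)\<close>, of modulus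
  at most 1 for \<open>s\<close> in the unit interval.\<close>

lemma abs_gbinomial_le_1:
  fixes s :: real
  assumes "0 \<le> s" "s \<le> 1"
  shows "\<bar>s gchoose k\<bar> \<le> 1"
proof (induction k)
  case (Suc k)
  have "real (Suc k) * (s gchoose Suc k) = (s - real k) * (s gchoose k)"
    using gbinomial_mult_1[of s k] by (simp add: algebra_simps)
  then have "real (Suc k) * \<bar>s gchoose Suc k\<bar> = \<bar>s - real k\<bar> * \<bar>s gchoose k\<bar>"
    by (metis abs_mult abs_of_nat)
  also have "\<dots> \<le> real (Suc k) * 1"
    using Suc assms by (intro mult_mono) auto
  finally show ?case by (simp only: mult_le_cancel_left_pos of_nat_0_less_iff zero_less_Suc)
qed simp

text \<open>Truncate the binomial series of \<open>(1 + (y - 1)) powr s\<close>. Its coefficients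
  are at most 1 in modulus, so a geometric series with ratio \<open>1 - y\<close> dominates the
  tail.\<close>

lemma powr_polynomial_approx:
  fixes s :: real
  assumes "0 \<le> s" "s \<le> 1" "n \<ge> 1"
  obtains p :: "real poly" where "degree p < n"
    "\<And>y. 0 < y \<Longrightarrow> y \<le> 1 \<Longrightarrow> \<bar>y powr s - poly p y\<bar> \<le> (1 - y) ^ n / y"
proof -
  define p where "p = (\<Sum>k<n. Polynomial.smult (s gchoose k) ([:-1, 1:] ^ k))"
  have "degree p \<le> n - 1"
    unfolding p_def
    by (intro degree_sum_le order_trans[OF degree_smult_le])
       (auto intro: order_trans[OF degree_power_le])
  then have "degree p < n" using assms by linarith
  moreover have "\<bar>y powr s - poly p y\<bar> \<le> (1 - y) ^ n / y" if y: "0 < y" "y \<le> 1" for y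
  proof -
    define f where "f = (\<lambda>k. (s gchoose k) * (y - 1) ^ k)"
    have "f sums (1 + (y - 1)) powr s"
      unfolding f_def using y by (intro gen_binomial_real) auto
    then have f: "f sums (y powr s)" by simp
    have "poly p y = (\<Sum>k<n. f k)"
      by (simp add: p_def poly_sum f_def)
    then have "y powr s - poly p y = (\<Sum>k. f (k + n))"
      using f suminf_minus_initial_segment[of f n] by (simp add: sums_iff)
    moreover have fk: "\<bar>f (k + n)\<bar> \<le> (1 - y) ^ n * (1 - y) ^ k" for k
    proof -
      have "\<bar>y - 1\<bar> = 1 - y" using y by simp
      then have "\<bar>f (k + n)\<bar> = \<bar>s gchoose (k + n)\<bar> * (1 - y) ^ (k + n)"
        by (simp add: f_def abs_mult power_abs)
      also have "\<dots> \<le> 1 * (1 - y) ^ (k + n)"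
        using abs_gbinomial_le_1[OF assms(1,2)] y by (intro mult_right_mono) auto
      finally show ?thesis by (simp add: power_add mult.commute)
    qed
    have "\<bar>\<Sum>k. f (k + n)\<bar> \<le> (\<Sum>k. (1 - y) ^ n * (1 - y) ^ k)"
      using y by (intro norm_suminf_le[of "\<lambda>k. f (k + n)", unfolded real_norm_def])
        (auto intro!: fk summable_mult summable_geometric)
    moreover have "(\<Sum>k. (1 - y) ^ n * (1 - y) ^ k) = (1 - y) ^ n / y"
      using y by (subst suminf_mult) (auto simp: suminf_geometric intro!: summable_geometric)
    ultimately show ?thesis by simp
  qed
  ultimately show thesis using that by blast
qed

text \<open>On a dyadic block of exponents, every exponential is a fixed combination of
  \<open>O(n)\<close> equispaced ones. With \<open>y = exp (- m c / (n + 1))\<close> the exponential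
  is \<open>y ^ q * y powr s\<close> with \<open>q > n\<close>, and this power of \<open>y\<close> turns the error
  \<open>(1 - y) ^ n / y\<close> of the binomial series into at most \<open>(y (1 - y)) ^ n\<close>.\<close>

lemma node_approx_exp:
  assumes n: "n \<ge> 1" and c: "c > 0" "c \<le> t" "t \<le> 2 * c" and N: "finite N"
    and nodes: "\<And>i. n + 1 \<le> i \<Longrightarrow> i \<le> 3 * (n + 1) \<Longrightarrow>
      complex_of_real (exp (- (c * real i / real (n + 1)))) \<in> N"
  shows "node_approx N ((1 / 4) ^ n) (\<lambda>m. complex_of_real (exp (- (real m * t))))"
proof -
  \<comment> \<open>This is \<open>t\<close> in units of the node spacing
    \<open>c / (n + 1)\<close>, so that the exponential becomes \<open>y powr x\<close>. The integer
    part \<open>q\<close> of \<open>x\<close> selects a node and the fractional part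
    \<open>s\<close> is left to the binomial series.\<close>
  define x where "x = t * real (n + 1) / c"
  have x: "real (n + 1) \<le> x" "x \<le> 2 * real (n + 1)"
  proof -
    have "x = t / c * real (n + 1)" by (simp add: x_def)
    moreover have "1 \<le> t / c" "t / c \<le> 2" using c by (auto simp: field_simps)
    ultimately have "1 * real (n + 1) \<le> x" "x \<le> 2 * real (n + 1)"
      by (auto simp only: intro!: mult_right_mono)
    then show "real (n + 1) \<le> x" "x \<le> 2 * real (n + 1)" by simp_all
  qed
  define q where "q = nat \<lfloor>x\<rfloor>"
  define s where "s = x - real q"
  have q: "real q \<le> x" "x < real q + 1"
    using x(1) unfolding q_def by linarith+
  then have s: "0 \<le> s" "s \<le> 1" by (auto simp: s_def)
  have qn: "n + 1 \<le> q" "q \<le> 2 * (n + 1)"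
    using q x by linarith+
  obtain p where p: "degree p < n"
    "\<And>y. 0 < y \<Longrightarrow> y \<le> 1 \<Longrightarrow> \<bar>y powr s - poly p y\<bar> \<le> (1 - y) ^ n / y"
    using powr_polynomial_approx[OF s n] by blast
  define y where "y = (\<lambda>m. exp (- (real m * c / real (n + 1))))"
  define r where "r = (\<lambda>i. complex_of_real (exp (- (c * real i / real (n + 1)))))"
  have ry: "r i ^ m = complex_of_real (y m ^ i)" for i m
    unfolding r_def y_def of_real_power[symmetric] exp_of_nat_mult[symmetric] by (simp add: mult_ac)
  \<comment> \<open>The index stays in the given range because \<open>q \<le> 2 * (n + 1)\<close>
    and the degree is below \<open>n\<close>.\<close>
  have rN: "r (q + i) \<in> N" if "i \<le> degree p" for i
    unfolding r_def using p(1) qn that by (intro nodes) auto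
  have "node_approx N (\<Sum>i\<le>degree p. norm (complex_of_real (Polynomial.coeff p i)) * 0)
     (\<lambda>m. \<Sum>i\<le>degree p. complex_of_real (Polynomial.coeff p i) * r (q + i) ^ m)"
    using N rN by (intro node_approx_sum node_approx_scale node_approx_power) auto
  moreover have "(\<Sum>i\<le>degree p. complex_of_real (Polynomial.coeff p i) * r (q + i) ^ m) =
      complex_of_real (y m ^ q * poly p (y m))" for m
    unfolding ry by (simp add: poly_altdef sum_distrib_left power_add mult_ac)
  ultimately have approx: "node_approx N 0 (\<lambda>m. complex_of_real (y m ^ q * poly p (y m)))"
    by simp
  have "norm (complex_of_real (exp (- (real m * t))) - complex_of_real (y m ^ q * poly p (y m))) \<le> (1 / 4) ^ n"
    for m
  proof -
    have y: "0 < y m" "y m \<le> 1" using c by (auto simp: y_def)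
    have "x * (real m * c / real (n + 1)) = real m * t"
      using c by (simp add: x_def)
    then have "- (real m * t) = (real q + s) * - (real m * c / real (n + 1))"
      by (simp add: s_def)
    then have "- (real m * t) = real q * - (real m * c / real (n + 1)) + s * - (real m * c / real (n + 1))"
      by (simp only: distrib_right)
    then have "exp (- (real m * t)) = y m ^ q * y m powr s"
      by (simp only: exp_add exp_of_nat_mult y_def powr_def ln_exp) simp
    then have "\<bar>exp (- (real m * t)) - y m ^ q * poly p (y m)\<bar> = y m ^ q * \<bar>y m powr s - poly p (y m)\<bar>"
      using y by (simp add: abs_mult flip: right_diff_distrib)
    also have "\<dots> \<le> y m ^ (n + 1) * ((1 - y m) ^ n / y m)"
      using y qn p(2) by (intro mult_mono power_decreasing) auto
    also have "\<dots> = (y m * (1 - y m)) ^ n"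
      using y by (simp add: power_mult_distrib)
    also have "\<dots> \<le> (1 / 4) ^ n"
    proof (rule power_mono)
      have "0 \<le> (y m - 1 / 2)\<^sup>2" by simp
      then show "y m * (1 - y m) \<le> 1 / 4" by (simp add: power2_eq_square algebra_simps)
    qed (use y in simp)
    finally show ?thesis by (simp only: norm_of_real of_real_diff[symmetric])
  qed
  then show ?thesis using node_approx_close[OF approx] by simp
qed

text \<open>A Riemann sum for the integral of \<open>exp (- m t)\<close> over positive
  \<open>t\<close>, with step \<open>h = 1 / 2 ^ k\<close> and points up to \<open>2 ^ k\<close>. It
  is a geometric sum, hence explicit: discretisation and truncation each cost at most
  \<open>h\<close>.\<close>

lemma reciprocal_riemann_sum:
  assumes m: "m \<ge> 1"
  shows "\<bar>1 / real m - (\<Sum>j=1..4 ^ k. (1 / 2 ^ k) * exp (- (real m * (real j / 2 ^ k))))\<bar> \<le> 2 / 2 ^ k"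
proof -
  define h where "h = (1 / 2 ^ k :: real)"
  define y where "y = exp (- (real m * h))"
  define x where "x = real m * h"
  have h: "0 < h" by (simp add: h_def)
  then have x: "0 < x" using m by (simp add: x_def)
  then have y: "0 < y" "y < 1" by (auto simp: y_def x_def)
  have ex: "exp x * y = 1" by (simp add: y_def x_def flip: exp_add)
  have ex1: "exp x - 1 \<ge> x" "exp x - 1 > 0" using x exp_ge_add_one_self[of x] by linarith+
  have "(\<Sum>j=1..4 ^ k. h * exp (- (real m * (real j / 2 ^ k)))) = (\<Sum>j=1..4 ^ k. h * y ^ j)"
    unfolding y_def h_def exp_of_nat_mult[symmetric] by (simp add: mult_ac)
  also have "\<dots> = h * (y * (\<Sum>j<4 ^ k. y ^ j))"
    unfolding sum_distrib_left
    by (rule sum.reindex_bij_witness[of _ Suc "\<lambda>j. j - 1"]) (auto simp flip: power_Suc)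
  also have "\<dots> = h * (y * ((1 - y ^ 4 ^ k) / (1 - y)))"
    using y by (simp add: sum_gp_strict)
  also have "y * ((1 - y ^ 4 ^ k) / (1 - y)) = (1 - y ^ 4 ^ k) / (exp x - 1)"
    using ex ex1 y by (simp add: divide_simps) (simp add: algebra_simps)
  finally have sum: "(\<Sum>j=1..4 ^ k. h * exp (- (real m * (real j / 2 ^ k)))) =
    h / (exp x - 1) - y ^ 4 ^ k * (h / (exp x - 1))"
    by (simp add: diff_divide_distrib algebra_simps)
  have hm: "h / x = 1 / real m" using h m by (simp add: x_def)
  have "h / (exp x - 1) \<le> h / x" using ex1 x h by (intro divide_left_mono) auto
  \<comment> \<open>Discretisation error: \<open>1 / x\<close> exceeds
    \<open>1 / (exp x - 1)\<close> by at most 1, a consequence of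
    \<open>1 - x \<le> exp (- x)\<close>.\<close>
  moreover have "h / x - h / (exp x - 1) \<le> h"
  proof -
    have "1 + - x \<le> exp (- x)" by (rule exp_ge_add_one_self)
    then have "(1 - x) * exp x \<le> exp (- x) * exp x" by (intro mult_right_mono) auto
    then have "(1 - x) * exp x \<le> 1" by (simp flip: exp_add)
    then have "exp x - 1 - x \<le> x * (exp x - 1)" by (simp add: algebra_simps)
    then have "(exp x - 1 - x) / (x * (exp x - 1)) \<le> 1" using x ex1 by simp
    moreover have "1 / x - 1 / (exp x - 1) = (exp x - 1 - x) / (x * (exp x - 1))"
      using x ex1 by (simp add: diff_frac_eq)
    ultimately have "h * (1 / x - 1 / (exp x - 1)) \<le> h * 1" using h by (intro mult_left_mono) auto
    then show ?thesis by (simp add: right_diff_distrib)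
  qed
  \<comment> \<open>Truncation error: the first factor is \<open>exp (- (m * 2 ^ k))\<close>, at
    most \<open>h\<close>, and the second is at most \<open>1 / m\<close>.\<close>
  moreover have "y ^ 4 ^ k * (h / (exp x - 1)) \<le> h"
  proof -
    have "y ^ 4 ^ k = exp (- (real m * 2 ^ k))"
      unfolding y_def exp_of_nat_mult[symmetric] h_def
      by (simp add: field_simps flip: power_mult_distrib)
    also have "\<dots> \<le> exp (- (2 ^ k))" using m by simp
    also have "\<dots> \<le> h"
    proof -
      have "2 ^ k \<le> exp (2 ^ k :: real)" using exp_ge_add_one_self[of "2 ^ k :: real"] by linarith
      then show ?thesis by (simp add: h_def exp_minus inverse_eq_divide frac_le)
    qed
    finally have "y ^ 4 ^ k \<le> h" .
    moreover have "h / (exp x - 1) \<le> 1"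
    proof -
      have "1 / real m \<le> 1" using m by simp
      then show ?thesis using \<open>h / (exp x - 1) \<le> h / x\<close> hm by linarith
    qed
    moreover have "0 \<le> h / (exp x - 1)" using h ex1 by simp
    ultimately have "y ^ 4 ^ k * (h / (exp x - 1)) \<le> h * 1" using h by (intro mult_mono) auto
    then show ?thesis by simp
  qed
  moreover have "0 \<le> y ^ 4 ^ k * (h / (exp x - 1))" using y h ex1 by simp
  ultimately have "\<bar>1 / real m - (\<Sum>j=1..4 ^ k. h * exp (- (real m * (real j / 2 ^ k))))\<bar> \<le> 2 * h"
    unfolding sum hm[symmetric] by linarith
  then show ?thesis by (simp add: h_def)
qed

text \<open>The Riemann sum has \<open>4 ^ k\<close> terms, but its points lie in
  \<open>2 * k\<close> dyadic blocks and all exponentials of one block share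
  \<open>2 * k + 3\<close> nodes. Each term has weight \<open>1 / 2 ^ k\<close> and error
  \<open>(1 / 4) ^ k\<close>, which adds up to \<open>1 / 2 ^ k\<close>; the Riemann sum itself
  contributes \<open>2 / 2 ^ k\<close>.\<close>

lemma exp_approx_reciprocal:
  assumes k: "k \<ge> 1"
  shows "exp_approx (3 / 2 ^ k) (2 * k * (2 * k + 3)) (\<lambda>m. complex_of_real (1 / real m))"
proof -
  define node where "node = (\<lambda>(l::nat, i::nat). complex_of_real (exp (- (2 ^ l / 2 ^ k * real i / real (k + 1)))))"
  define N where "N = node ` ({..<2 * k} \<times> {k + 1..3 * (k + 1)})"
  have N: "finite N" by (simp add: N_def)
  have card: "card N \<le> 2 * k * (2 * k + 3)"
    using card_image_le[of "{..<2 * k} \<times> {k + 1..3 * (k + 1)}" node]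
    by (simp add: N_def card_cartesian_product)
  have disc: "r \<noteq> 0 \<and> norm r < 1" if "r \<in> N" for r
    using that k unfolding N_def node_def by auto
  have "node_approx N ((1 / 4) ^ k) (\<lambda>m. complex_of_real (exp (- (real m * (real j / 2 ^ k)))))"
    if j: "j \<in> {1..4 ^ k}" for j
  proof -
    \<comment> \<open>The blocks are closed on the right, so that the last point
      \<open>j = 4 ^ k\<close> belongs to block \<open>2 * k - 1\<close> and needs no block of its
      own.\<close>
    obtain l where l: "l < 2 * k" "2 ^ l \<le> j" "j \<le> 2 * 2 ^ l"
    proof -
      obtain l where l: "2 ^ l \<le> j" "j < 2 ^ (l + 1)" using ex_power_ivl1[of 2 j] j by auto
      have "(4::nat) ^ k = 2 ^ (2 * k)" by (simp add: power_mult)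
      then have jk: "j \<le> 2 ^ (2 * k)" using j by simp
      show thesis
      proof (cases "l < 2 * k")
        case True
        then show ?thesis using that[of l] l by simp
      next
        case False
        then have "(2::nat) ^ (2 * k) \<le> 2 ^ l" by (intro power_increasing) auto
        then have "j = 2 ^ (2 * k)" using l jk by linarith
        also have "(2::nat) ^ (2 * k) = 2 * 2 ^ (2 * k - 1)" using k by (subst power_Suc[symmetric]) simp
        finally show ?thesis using that[of "2 * k - 1"] k by simp
      qed
    qed
    show ?thesis
    proof (rule node_approx_exp[of k "2 ^ l / 2 ^ k"])
      have "real (2 ^ l) \<le> real j" "real j \<le> real (2 * 2 ^ l)" using l by (simp_all only: of_nat_le_iff)
      then show "2 ^ l / 2 ^ k \<le> real j / 2 ^ k" "real j / 2 ^ k \<le> 2 * (2 ^ l / 2 ^ k)"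
        by (auto simp: divide_right_mono)
      fix i assume "k + 1 \<le> i" "i \<le> 3 * (k + 1)"
      then show "complex_of_real (exp (- (2 ^ l / 2 ^ k * real i / real (k + 1)))) \<in> N"
        unfolding N_def node_def using l(1) by (intro image_eqI[where x = "(l, i)"]) auto
    qed (use k N in auto)
  qed
  then have "node_approx N (\<Sum>j\<in>{1..4 ^ k::nat}. norm (complex_of_real (1 / 2 ^ k)) * (1 / 4) ^ k)
     (\<lambda>m. \<Sum>j=1..4 ^ k. complex_of_real (1 / 2 ^ k) * complex_of_real (exp (- (real m * (real j / 2 ^ k)))))"
    by (intro node_approx_sum node_approx_scale) auto
  moreover have "(\<Sum>j\<in>{1..4 ^ k::nat}. norm (complex_of_real (1 / 2 ^ k)) * (1 / 4) ^ k) = (1 / 2 ^ k :: real)"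
    by (simp add: norm_divide norm_power power_divide)
  ultimately have "node_approx N (1 / 2 ^ k)
     (\<lambda>m. complex_of_real (\<Sum>j=1..4 ^ k. (1 / 2 ^ k) * exp (- (real m * (real j / 2 ^ k)))))"
    by (simp only: of_real_sum of_real_mult)
  then have "node_approx N (1 / 2 ^ k + 2 / 2 ^ k) (\<lambda>m. complex_of_real (1 / real m))"
    by (rule node_approx_close) (simp only: norm_of_real reciprocal_riemann_sum flip: of_real_diff)
  then have "node_approx N (3 / 2 ^ k) (\<lambda>m. complex_of_real (1 / real m))" by simp
  then show ?thesis using N card disc by (intro exp_approxI[of N])
qed

lemma log_approx_reciprocal: "log_approx (\<lambda>m. complex_of_real (1 / real m))"
proof (rule log_approxI[of 40 3])
  fix \<eta> :: real assume \<eta>: "0 < \<eta>" "\<eta> < 1"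
  let ?L = "ln (3 / \<eta>)"
  have "3 / \<eta> > 1" using \<eta> by simp
  then have L: "?L > 0" by (rule ln_gt_zero)
  define k where "k = nat \<lceil>?L / ln 2\<rceil>"
  have "?L / ln 2 > 0" using L by simp
  then have k: "?L / ln 2 \<le> real k" "real k \<le> ?L / ln 2 + 1" "k \<ge> 1"
    unfolding k_def by linarith+
  have "?L \<le> real k * ln 2" using k(1) by (simp add: pos_divide_le_eq)
  then have "exp ?L \<le> exp (real k * ln 2)" by (simp only: exp_le_cancel_iff)
  then have "3 / \<eta> \<le> 2 ^ k" using \<eta> by (simp add: exp_of_nat_mult)
  then have "3 / 2 ^ k \<le> \<eta>" using \<eta> by (simp add: field_simps)
  then have "exp_approx \<eta> (2 * k * (2 * k + 3)) (\<lambda>m. complex_of_real (1 / real m))"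
    using exp_approx_reciprocal[OF k(3)] exp_approx_mono by blast
  \<comment> \<open>The left side is at most \<open>10 * k\<^sup>2\<close> for
    \<open>k \<ge> 1\<close>, and \<open>k \<le> 2 * (1 + ?L)\<close> because \<open>ln 2\<close> is
    at least one half.\<close>
  moreover have "real (2 * k * (2 * k + 3)) \<le> 40 * (1 + ?L)\<^sup>2"
  proof -
    have "ln 2 \<ge> (1 / 2 :: real)" using exp_half_le2 by (subst ln_ge_iff) auto
    then have "?L / ln 2 \<le> ?L / (1 / 2)" using L by (intro divide_left_mono) auto
    then have k2: "real k \<le> 2 * (1 + ?L)" using k(2) by simp
    have "2 * k * (2 * k + 3) \<le> 2 * k * (5 * k)" using k(3) by (intro mult_left_mono) auto
    then have "2 * k * (2 * k + 3) \<le> 10 * k\<^sup>2" by (simp add: power2_eq_square)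
    then have "real (2 * k * (2 * k + 3)) \<le> real (10 * k\<^sup>2)" by (simp only: of_nat_le_iff)
    also have "\<dots> = 10 * (real k)\<^sup>2" by simp
    also have "\<dots> \<le> 10 * (2 * (1 + ?L))\<^sup>2" using k2 by (intro mult_left_mono power_mono) auto
    finally show ?thesis by (simp add: power2_eq_square algebra_simps)
  qed
  ultimately show "\<exists>S. real S \<le> 40 * (1 + ln (3 / \<eta>))\<^sup>2 \<and> exp_approx \<eta> S (\<lambda>m. complex_of_real (1 / real m))"
    by blast
qed auto

section \<open>Fourier coefficients\<close>

abbreviation circle_measure :: "real measure" where
  "circle_measure \<equiv> lebesgue_on {0..2 * pi}"

text \<open>Stated for functions of the angle, since the building blocks, such as \<open>t\<close>
  itself and steps in \<open>t\<close>, are naturally given in this form.\<close>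

definition fc :: "(real \<Rightarrow> complex) \<Rightarrow> int \<Rightarrow> complex" where
  "fc u k = (LINT t|circle_measure. u t * cis (- (of_int k * t))) / (2 * of_real pi)"

definition log_symbol :: "(real \<Rightarrow> complex) \<Rightarrow> bool" where
  "log_symbol u \<longleftrightarrow> integrable circle_measure u \<and>
     log_approx (\<lambda>m. fc u (int m)) \<and> log_approx (\<lambda>m. fc u (- int m))"

section \<open>Calculus of Fourier coefficients\<close>

lemma integrable_mult_bounded:
  fixes u v :: "real \<Rightarrow> complex"
  assumes "integrable (lebesgue_on {a..b}) u" "continuous_on {a..b} v"
  shows "integrable (lebesgue_on {a..b}) (\<lambda>t. u t * v t)"
proof -
  have "bounded (v ` {a..b})" using assms(2) by (intro compact_imp_bounded compact_continuous_image) auto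
  then obtain B where B: "\<And>t. t \<in> {a..b} \<Longrightarrow> norm (v t) \<le> B" unfolding bounded_iff by blast
  have "v \<in> borel_measurable (lebesgue_on {a..b})"
    using assms(2) by (rule continuous_imp_measurable_on_sets_lebesgue) auto
  moreover have "u \<in> borel_measurable (lebesgue_on {a..b})" using assms(1) by (rule borel_measurable_integrable)
  ultimately have m: "(\<lambda>t. u t * v t) \<in> borel_measurable (lebesgue_on {a..b})" by measurable
  have "integrable (lebesgue_on {a..b}) (\<lambda>t. of_real B * u t)" using assms(1) by simp
  then show ?thesis
  proof (rule Bochner_Integration.integrable_bound[OF _ m])
    show "AE t in lebesgue_on {a..b}. norm (u t * v t) \<le> norm (of_real B * u t)"
    proof (rule AE_I2)
      fix t assume "t \<in> space (lebesgue_on {a..b})"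
      then have "norm (v t) \<le> \<bar>B\<bar>" using B[of t] by (auto simp: space_restrict_space)
      then show "norm (u t * v t) \<le> norm (of_real B * u t)"
        by (simp add: norm_mult mult.commute[of "norm (u t)"] mult_right_mono)
    qed
  qed
qed

lemma continuous_cis_mult: "continuous_on S (\<lambda>t. cis (- (of_int k * t)))"
  by (intro continuous_intros)

lemma integrable_fc:
  assumes "integrable circle_measure u"
  shows "integrable circle_measure (\<lambda>t. u t * cis (- (of_int k * t)))"
  using assms continuous_cis_mult by (rule integrable_mult_bounded)

lemma fc_add:
  assumes "integrable circle_measure u" "integrable circle_measure v"
  shows "fc (\<lambda>t. u t + v t) k = fc u k + fc v k"
  using assms[THEN integrable_fc, of k] by (simp add: fc_def distrib_right add_divide_distrib)

lemma fc_scale: "fc (\<lambda>t. c * u t) k = c * fc u k"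
  by (simp add: fc_def mult.assoc)

lemma fc_mult_cis: "fc (\<lambda>t. cis t * u t) k = fc u (k - 1)"
proof -
  have "cis t * cis (- (of_int k * t)) = cis (- (of_int (k - 1) * t))" for t
    by (simp add: cis_mult algebra_simps)
  then have "cis t * u t * cis (- (of_int k * t)) = u t * cis (- (of_int (k - 1) * t))" for t
    by (simp only: mult.commute[of "cis t"] mult.assoc)
  then show ?thesis by (simp only: fc_def)
qed

lemma fc_cong_AE:
  assumes "integrable circle_measure u" "v \<in> borel_measurable circle_measure"
    "AE t in circle_measure. u t = v t"
  shows "fc u k = fc v k"
proof -
  have cm: "(\<lambda>t. cis (- (of_int k * t))) \<in> borel_measurable circle_measure"
    using continuous_cis_mult by (rule continuous_imp_measurable_on_sets_lebesgue) auto
  have um: "u \<in> borel_measurable circle_measure" using assms by (intro borel_measurable_integrable)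
  have "(LINT t|circle_measure. u t * cis (- (of_int k * t))) = (LINT t|circle_measure. v t * cis (- (of_int k * t)))"
  proof (rule integral_cong_AE)
    show "(\<lambda>t. u t * cis (- (of_int k * t))) \<in> borel_measurable circle_measure"
      "(\<lambda>t. v t * cis (- (of_int k * t))) \<in> borel_measurable circle_measure"
      using cm um assms(2) by measurable
    show "AE t in circle_measure. u t * cis (- (of_int k * t)) = v t * cis (- (of_int k * t))"
      using assms(3) by eventually_elim simp
  qed
  then show ?thesis by (simp add: fc_def)
qed

lemma fc_cnj: "fc (\<lambda>t. cnj (u t)) k = cnj (fc u (- k))"
proof -
  have "cnj (u t) * cis (- (of_int k * t)) = cnj (u t * cis (- (of_int (- k) * t)))" for t
    by (simp add: cis_cnj)
  then show ?thesis unfolding fc_def by (simp only: Bochner_Integration.integral_cnj) simp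
qed

lemma fc_has_integral:
  assumes "integrable circle_measure u"
  shows "((\<lambda>t. u t * cis (- (of_int k * t))) has_integral (2 * of_real pi * fc u k)) {0..2 * pi}"
  using has_integral_integral_lebesgue_on[OF integrable_fc[OF assms, of k]] by (simp add: fc_def)

text \<open>Lebesgue integrability is established separately, so that the value may be computed as a
  gauge integral by the fundamental theorem of calculus.\<close>

lemma fc_eqI:
  assumes "integrable circle_measure u"
    "((\<lambda>t. u t * cis (- (of_int k * t))) has_integral I) {0..2 * pi}"
  shows "fc u k = I / (2 * of_real pi)"
  using has_integral_unique[OF fc_has_integral[OF assms(1)] assms(2)] by (simp add: field_simps)

section \<open>Closure properties of \<open>log_symbol\<close>\<close>

lemma log_symbol_add:
  assumes "log_symbol u" "log_symbol v"
  shows "log_symbol (\<lambda>t. u t + v t)"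
  using assms unfolding log_symbol_def by (simp add: fc_add log_approx_add)

lemma log_symbol_scale:
  assumes "log_symbol u"
  shows "log_symbol (\<lambda>t. c * u t)"
  using assms unfolding log_symbol_def by (simp add: fc_scale log_approx_scale)

lemma log_approx_0: "log_approx (\<lambda>m. 0)"
  by (rule log_approx_exp_decay[of "1/2" _ 0]) auto

lemma log_symbol_0: "log_symbol (\<lambda>t. 0)"
  unfolding log_symbol_def by (simp add: fc_def log_approx_0)

lemma log_symbol_sum:
  assumes "finite I" "\<And>i. i \<in> I \<Longrightarrow> log_symbol (u i)"
  shows "log_symbol (\<lambda>t. \<Sum>i\<in>I. u i t)"
  using assms by (induction rule: finite_induct) (simp_all add: log_symbol_0 log_symbol_add)

lemma log_symbol_cong_AE:
  assumes "log_symbol u" "v \<in> borel_measurable circle_measure"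
    "AE t in circle_measure. u t = v t"
  shows "log_symbol v"
proof -
  have u: "integrable circle_measure u" using assms(1) by (simp add: log_symbol_def)
  then have "integrable circle_measure v"
    using integrable_cong_AE[OF borel_measurable_integrable[OF u] assms(2,3)] by simp
  then show ?thesis using assms(1) fc_cong_AE[OF u assms(2,3)] by (simp add: log_symbol_def)
qed

text \<open>The coefficient at \<open>k\<close> becomes the old one at \<open>k - 1\<close>. For
  nonnegative indices a shift has to be undone, for nonpositive ones a shift is performed.\<close>

lemma log_symbol_mult_cis:
  assumes "log_symbol u"
  shows "log_symbol (\<lambda>t. cis t * u t)"
proof -
  have u: "integrable circle_measure u" "log_approx (\<lambda>m. fc u (int m))" "log_approx (\<lambda>m. fc u (- int m))"
    using assms by (simp_all add: log_symbol_def)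
  have "integrable circle_measure (\<lambda>t. u t * cis t)"
    by (rule integrable_mult_bounded[OF u(1)]) (intro continuous_intros)
  then have "integrable circle_measure (\<lambda>t. cis t * u t)" by (simp only: mult.commute)
  moreover have "fc (\<lambda>t. cis t * u t) (int (Suc m)) = fc u (int m)" for m
    by (subst fc_mult_cis) simp
  then have "log_approx (\<lambda>m. fc (\<lambda>t. cis t * u t) (int (Suc m)))"
    using u(2) by (simp only:)
  then have "log_approx (\<lambda>m. fc (\<lambda>t. cis t * u t) (int m))"
    by (rule log_approx_unshift)
  moreover have "fc (\<lambda>t. cis t * u t) (- int m) = fc u (- int (Suc m))" for m
    by (subst fc_mult_cis) (rule arg_cong[of _ _ "fc u"], simp)
  then have "log_approx (\<lambda>m. fc (\<lambda>t. cis t * u t) (- int m))"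
    using log_approx_shift[OF u(3)] by (simp only:)
  ultimately show ?thesis unfolding log_symbol_def by blast
qed

lemma log_symbol_mult_power:
  assumes "log_symbol u"
  shows "log_symbol (\<lambda>t. (cis t - z) ^ k * u t)"
proof (induction k)
  case 0
  then show ?case using assms by simp
next
  case (Suc k)
  have "log_symbol (\<lambda>t. cis t * ((cis t - z) ^ k * u t) + (- z) * ((cis t - z) ^ k * u t))"
    by (rule log_symbol_add[OF log_symbol_mult_cis[OF Suc] log_symbol_scale[OF Suc]])
  then show ?case by (simp add: algebra_simps)
qed

text \<open>A real function has conjugate Fourier coefficients at opposite indices.\<close>

lemma log_symbol_of_real:
  assumes "integrable circle_measure v" "log_approx (\<lambda>m. fc (\<lambda>t. of_real (v t)) (int m))"
  shows "log_symbol (\<lambda>t. of_real (v t))"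
proof -
  have "fc (\<lambda>t. of_real (v t)) (- int m) = cnj (fc (\<lambda>t. of_real (v t)) (int m))" for m
    using fc_cnj[of "\<lambda>t. of_real (v t)" "- int m"] by simp
  then have "log_approx (\<lambda>m. fc (\<lambda>t. of_real (v t)) (- int m))"
    using log_approx_cnj[OF assms(2)] by (simp only:)
  moreover have "integrable circle_measure (\<lambda>t. complex_of_real (v t))"
    using assms(1) by (rule integrable_of_real)
  ultimately show ?thesis using assms(2) unfolding log_symbol_def by blast
qed

lemma log_approx_unit_power_over:
  assumes "norm z = 1" "\<And>m. m \<ge> 1 \<Longrightarrow> h m = c * (z ^ m / of_nat m)"
  shows "log_approx h"
proof -
  have "log_approx (\<lambda>m. c * (z ^ m * complex_of_real (1 / real m)))"
    using assms(1) by (intro log_approx_scale log_approx_modulate log_approx_reciprocal)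
  then show ?thesis by (rule log_approx_cong) (simp add: assms(2) divide_inverse)
qed


section \<open>Coefficients of steps, constants and the angle\<close>

lemma cis_has_vector_derivative:
  "((\<lambda>t. cis (- (of_int k * t))) has_vector_derivative (- \<i> * of_int k * cis (- (of_int k * t)))) (at t)"
proof -
  have "((\<lambda>z. exp (- \<i> * of_int k * z)) has_field_derivative
     (- \<i> * of_int k * exp (- \<i> * of_int k * of_real t))) (at (of_real t))"
    by (auto intro!: derivative_eq_intros)
  then have "((\<lambda>t. exp (- \<i> * of_int k * of_real t)) has_vector_derivative
     (- \<i> * of_int k * exp (- \<i> * of_int k * of_real t))) (at t)"
    by (rule has_vector_derivative_real_field)
  then show ?thesis by (simp add: cis_conv_exp mult.assoc)
qed

lemma cis_int_mult_two_pi: "cis (- (of_int k * (2 * pi))) = 1"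
  using cis_multiple_2pi[of "- of_int k"] by (simp add: mult_ac)

lemma integrable_step: "integrable circle_measure (\<lambda>t. if t > \<tau> then 1 else 0 :: real)"
proof (rule Bochner_Integration.integrable_bound)
  show "integrable circle_measure (\<lambda>t. 1 :: real)"
    by (intro continuous_imp_integrable_real continuous_intros)
  have "(\<lambda>t. if t > \<tau> then 1 else 0 :: real) \<in> borel_measurable borel" by measurable
  then show "(\<lambda>t. if t > \<tau> then 1 else 0 :: real) \<in> borel_measurable circle_measure"
    by (intro measurable_restrict_space1 measurable_completion) simp
qed auto

text \<open>The maximum makes the primitive \<open>F\<close> continuous and constant to the left of
  the jump, and it also covers \<tau> outside the interval.\<close>

lemma fc_step:
  fixes \<tau> :: real
  assumes "k \<noteq> 0"
  shows "fc (\<lambda>t. of_real (if t > \<tau> then 1 else 0)) k =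
    \<i> / (2 * of_real pi * of_int k) * (cis (- (of_int k * max (2 * pi) \<tau>)) - cis (- (of_int k * max 0 \<tau>)))"
    (is "fc ?u k = _")
proof -
  define F where "F = (\<lambda>t. \<i> / of_int k * cis (- (of_int k * max t \<tau>)))"
  have "((\<lambda>t. ?u t * cis (- (of_int k * t))) has_integral (F (2 * pi) - F 0)) {0..2 * pi}"
  proof (rule fundamental_theorem_of_calculus_interior_strong[of "{\<tau>}"])
    show "continuous_on {0..2 * pi} F" unfolding F_def by (intro continuous_intros)
    fix t assume t: "t \<in> {0<..<2 * pi} - {\<tau>}"
    show "(F has_vector_derivative ?u t * cis (- (of_int k * t))) (at t)"
    proof (cases "t > \<tau>")
      case True
      have "((\<lambda>t. \<i> / of_int k * cis (- (of_int k * t))) has_vector_derivative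
         (\<i> / of_int k * (- \<i> * of_int k * cis (- (of_int k * t))))) (at t)"
        by (intro has_vector_derivative_mult_right cis_has_vector_derivative)
      then have "((\<lambda>t. \<i> / of_int k * cis (- (of_int k * t))) has_vector_derivative
         ?u t * cis (- (of_int k * t))) (at t)"
        using True assms by simp
      then show ?thesis
        by (rule has_vector_derivative_transform_within_open[of _ _ _ "{\<tau><..}"])
           (use True in \<open>auto simp: F_def\<close>)
    next
      case False
      then have lt: "t < \<tau>" using t by simp
      have "((\<lambda>t. \<i> / of_int k * cis (- (of_int k * \<tau>))) has_vector_derivative 0) (at t)"
        by (rule has_vector_derivative_const)
      then have "(F has_vector_derivative 0) (at t)"
        by (rule has_vector_derivative_transform_within_open[of _ _ _ "{..<\<tau>}"])
           (use lt in \<open>auto simp: F_def\<close>)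
      then show ?thesis using False by simp
    qed
  qed auto
  moreover have "integrable circle_measure ?u" using integrable_step by (rule integrable_of_real)
  ultimately have "fc ?u k = (F (2 * pi) - F 0) / (2 * of_real pi)" by (intro fc_eqI)
  then show "fc ?u k = \<i> / (2 * of_real pi * of_int k) *
     (cis (- (of_int k * max (2 * pi) \<tau>)) - cis (- (of_int k * max 0 \<tau>)))"
    by (simp add: F_def right_diff_distrib diff_divide_distrib mult_ac)
qed

lemma cis_int_power: "cis (- (of_int (int m) * s)) = cis (- s) ^ m"
  by (simp only: Complex.DeMoivre of_int_of_nat_eq mult_minus_right)

lemma log_symbol_step: "log_symbol (\<lambda>t. of_real (if t > \<tau> then 1 else 0))"
proof (rule log_symbol_of_real[OF integrable_step])
  have "log_approx (\<lambda>m. (\<i> / (2 * of_real pi)) * (cis (- max (2 * pi) \<tau>) ^ m / of_nat m)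
      + (- \<i> / (2 * of_real pi)) * (cis (- max 0 \<tau>) ^ m / of_nat m))"
    by (intro log_approx_add log_approx_unit_power_over[OF _ refl]) auto
  then show "log_approx (\<lambda>m. fc (\<lambda>t. of_real (if t > \<tau> then 1 else 0)) (int m))"
  proof (rule log_approx_cong)
    fix m :: nat assume "m \<ge> 1"
    then show "fc (\<lambda>t. of_real (if t > \<tau> then 1 else 0)) (int m) =
      (\<i> / (2 * of_real pi)) * (cis (- max (2 * pi) \<tau>) ^ m / of_nat m)
      + (- \<i> / (2 * of_real pi)) * (cis (- max 0 \<tau>) ^ m / of_nat m)"
      by (subst fc_step) (simp_all only: cis_int_power, simp_all add: right_diff_distrib)
  qed
qed

lemma fc_const_1: "fc (\<lambda>t. 1) k = (if k = 0 then 1 else 0)"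
proof (cases "k = 0")
  case True
  have "fc (\<lambda>t. 1) k = 2 * of_real pi / (2 * of_real pi)"
  proof (rule fc_eqI)
    show "integrable circle_measure (\<lambda>t. 1 :: complex)"
      by (intro continuous_imp_integrable_real continuous_intros)
    show "((\<lambda>t. 1 * cis (- (of_int k * t))) has_integral 2 * of_real pi) {0..2 * pi}"
      using has_integral_const_real[of "1 :: complex" 0 "2 * pi"] True by (simp add: scaleR_conv_of_real)
  qed
  then show ?thesis using True by simp
next
  case False
  have "integrable circle_measure (\<lambda>t. 1 :: complex)"
    by (intro continuous_imp_integrable_real continuous_intros)
  \<comment> \<open>On the interval the constant is a step whose jump lies to the left of 0, so that
    \<open>fc_step\<close> applies.\<close>
  then have "fc (\<lambda>t. 1) k = fc (\<lambda>t. of_real (if t > -1 then 1 else 0)) k"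
  proof (rule fc_cong_AE)
    show "(\<lambda>t. complex_of_real (if t > -1 then 1 else 0)) \<in> borel_measurable circle_measure"
      using integrable_of_real[OF integrable_step] by (rule borel_measurable_integrable)
  qed (rule AE_I2, simp)
  also have "\<dots> = 0"
    unfolding fc_step[OF False] using cis_int_mult_two_pi[of k] pi_gt_zero by (simp add: max_def del: pi_gt_zero)
  finally show ?thesis using False by simp
qed

lemma log_symbol_const: "log_symbol (\<lambda>t. c)"
proof -
  have "log_approx (\<lambda>m. fc (\<lambda>t. 1) (int m))" "log_approx (\<lambda>m. fc (\<lambda>t. 1) (- int m))"
    by (rule log_approx_cong[OF log_approx_0]; simp add: fc_const_1)+
  then have "log_symbol (\<lambda>t. 1)" unfolding log_symbol_def
    by (auto intro!: continuous_imp_integrable_real continuous_intros)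
  then show ?thesis using log_symbol_scale[of "\<lambda>t. 1" c] by simp
qed

lemma log_symbol_id: "log_symbol (\<lambda>t. of_real t)"
proof (rule log_symbol_of_real)
  show int: "integrable circle_measure (\<lambda>t. t)"
    by (intro continuous_imp_integrable_real continuous_intros)
  show "log_approx (\<lambda>m. fc (\<lambda>t. of_real t) (int m))"
  proof (rule log_approx_unit_power_over[of 1 _ \<i>])
    fix m :: nat assume m: "m \<ge> 1"
    \<comment> \<open>Primitive found by integration by parts. Only its first summand differs at the
      two ends, which yields the coefficient \<open>\<i> / m\<close>.\<close>
    define F where "F = (\<lambda>t. cis (- (of_int (int m) * t)) * (\<i> * of_real t / of_nat m + 1 / (of_nat m)\<^sup>2))"
    have "((\<lambda>t. of_real t * cis (- (of_int (int m) * t))) has_integral (F (2 * pi) - F 0)) {0..2 * pi}"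
    proof (rule fundamental_theorem_of_calculus_interior_strong[of "{}"])
      show "continuous_on {0..2 * pi} F" unfolding F_def by (intro continuous_intros) (use m in auto)
      fix t
      have "((\<lambda>t. \<i> * of_real t / of_nat m + 1 / (of_nat m)\<^sup>2) has_vector_derivative \<i> / of_nat m) (at t)"
        using m by (auto intro!: derivative_eq_intros simp: has_vector_derivative_def scaleR_conv_of_real)
      from has_vector_derivative_mult[OF cis_has_vector_derivative[of "int m"] this]
      show "(F has_vector_derivative of_real t * cis (- (of_int (int m) * t))) (at t)"
        unfolding F_def by (rule has_vector_derivative_eq_rhs) (use m in \<open>auto simp: field_simps power2_eq_square\<close>)
    qed auto
    moreover have "F (2 * pi) - F 0 = 2 * of_real pi * \<i> / of_nat m"
      unfolding F_def cis_int_mult_two_pi by simp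
    ultimately have "fc (\<lambda>t. of_real t) (int m) = (2 * of_real pi * \<i> / of_nat m) / (2 * of_real pi)"
      by (intro fc_eqI integrable_of_real[OF int]) simp
    then show "fc (\<lambda>t. of_real t) (int m) = \<i> * (1 ^ m / of_nat m)" by simp
  qed simp
qed

section \<open>The logarithm of the chord\<close>

text \<open>By \<open>x * ln x\<close> tending to 0, a factor \<open>w\<close> removes the
  singularity. This keeps the primitives below continuous where the chord vanishes.\<close>

lemma isCont_mult_ln_norm: "isCont (\<lambda>w::complex. w * of_real (ln (norm w))) w"
proof (cases "w = 0")
  case False
  then show ?thesis by (intro continuous_intros) auto
next
  case True
  have "((\<lambda>x. x * ln x) \<longlongrightarrow> 0) (at_right (0::real))" by real_asymp
  moreover have "filterlim norm (at_right 0) (at (0::complex))"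
    unfolding filterlim_at by (auto simp: eventually_at_filter intro!: tendsto_eq_intros)
  ultimately have "((\<lambda>w::complex. norm w * ln (norm w)) \<longlongrightarrow> 0) (at 0)"
    by (rule filterlim_compose)
  then have "((\<lambda>w::complex. w * of_real (ln (norm w))) \<longlongrightarrow> 0) (at 0)"
    by (subst tendsto_norm_zero_iff[symmetric], subst (asm) tendsto_rabs_zero_iff[symmetric])
       (simp add: norm_mult abs_mult)
  then show ?thesis using True by (simp add: isCont_def)
qed

lemma norm_cis_diff_sq: "(norm (cis t - cis s))\<^sup>2 = 2 - 2 * cos (t - s)"
proof -
  have "(norm (cis t - cis s))\<^sup>2 = ((cos t)\<^sup>2 + (sin t)\<^sup>2) + ((cos s)\<^sup>2 + (sin s)\<^sup>2) - 2 * (cos t * cos s + sin t * sin s)"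
    unfolding cmod_power2 by (simp add: power2_eq_square algebra_simps)
  then show ?thesis by (simp add: cos_diff)
qed

lemma ln_norm_cis_diff: "ln (norm (cis t - cis s)) = ln (2 - 2 * cos (t - s)) / 2"
proof (cases "cis t = cis s")
  \<comment> \<open>Here both arguments of \<open>ln\<close> are 0 and the convention
    \<open>ln 0 = 0\<close> makes the sides agree.\<close>
  case True
  then show ?thesis using norm_cis_diff_sq[of t s] by simp
next
  case False
  then show ?thesis unfolding norm_cis_diff_sq[symmetric] by (subst ln_realpow) auto
qed

text \<open>The sine is linear in the chord, so that its product with the logarithm of the chord
  inherits continuity from \<open>continuous_on_chord_mult_ln\<close>.\<close>

lemma sin_eq_Im_cis_diff: "sin (t - s) = Im (cnj (cis s) * (cis t - cis s))"
  by (simp add: sin_diff algebra_simps)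

lemma cis_eq_iff_cos: "cis t = cis s \<longleftrightarrow> cos (t - s) = 1"
  using norm_cis_diff_sq[of t s] by auto

lemma finite_cis_eq: "finite {t \<in> {0..2 * pi}. cis t = cis s}"
proof -
  have "{t \<in> {0..2 * pi}. cis t = cis s} \<subseteq> (\<lambda>n::int. s + of_int n * (2 * pi)) ` {\<lfloor>- s / (2 * pi)\<rfloor>..\<lceil>(2 * pi - s) / (2 * pi)\<rceil>}"
  proof safe
    fix t assume t: "t \<in> {0..2 * pi}" "cis t = cis s"
    then obtain n :: int where n: "t - s = of_int n * 2 * pi"
      unfolding cis_eq_iff_cos cos_one_2pi_int by auto
    have "of_int n = (t - s) / (2 * pi)" using n by simp
    then have "- s / (2 * pi) \<le> of_int n" "of_int n \<le> (2 * pi - s) / (2 * pi)"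
      using t divide_right_mono[of "- s" "t - s" "2 * pi"] divide_right_mono[of "t - s" "2 * pi - s" "2 * pi"]
      by auto
    then have "n \<in> {\<lfloor>- s / (2 * pi)\<rfloor>..\<lceil>(2 * pi - s) / (2 * pi)\<rceil>}"
      by (auto simp: floor_le_iff le_ceiling_iff)
    then show "t \<in> (\<lambda>n::int. s + of_int n * (2 * pi)) ` {\<lfloor>- s / (2 * pi)\<rfloor>..\<lceil>(2 * pi - s) / (2 * pi)\<rceil>}"
      using n by (intro image_eqI[of _ _ n]) auto
  qed
  then show ?thesis by (rule finite_subset) auto
qed

lemma ln_chord_has_derivative:
  assumes "cis t \<noteq> cis s"
  shows "((\<lambda>t. ln (norm (cis t - cis s))) has_real_derivative sin (t - s) / (2 - 2 * cos (t - s))) (at t)"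
proof -
  have "cos (t - s) < 1" using assms cos_le_one[of "t - s"] unfolding cis_eq_iff_cos by linarith
  then have pos: "0 < 2 - 2 * cos (t - s)" by simp
  have "((\<lambda>t. 2 - 2 * cos (t - s)) has_real_derivative 2 * sin (t - s)) (at t)"
    by (auto intro!: derivative_eq_intros)
  from DERIV_cdivide[OF DERIV_chain2[OF DERIV_ln_divide[OF pos] this], of 2]
  show ?thesis
  proof (rule DERIV_cong[OF DERIV_cong_ev[THEN iffD1, OF refl _ refl], rotated])
    have "1 / v * (2 * x) / 2 = x / v" for v x :: real by simp
    then show "1 / (2 - 2 * cos (t - s)) * (2 * sin (t - s)) / 2 = sin (t - s) / (2 - 2 * cos (t - s))" .
  qed (simp add: ln_norm_cis_diff)
qed

lemma continuous_on_chord_mult_ln: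
  "continuous_on A (\<lambda>t. (cis t - cis s) * of_real (ln (norm (cis t - cis s))))"
proof -
  have "continuous_on UNIV (\<lambda>w::complex. w * of_real (ln (norm w)))"
    using isCont_mult_ln_norm by (simp add: continuous_on_eq_continuous_at)
  then show ?thesis
    by (rule continuous_on_compose2[of UNIV _ A "\<lambda>t. cis t - cis s"]) (auto intro!: continuous_intros)
qed

text \<open>With \<open>x = t - s\<close>, the function \<open>cos x * ln \<bar>cis t - cis s\<bar>\<close> is bounded above and has
  an explicit continuous primitive, so that it is absolutely integrable; its difference to
  the logarithm itself is bounded.\<close>

lemma integrable_ln_chord: "integrable circle_measure (\<lambda>t. ln (norm (cis t - cis s)))"
proof -
  let ?l = "\<lambda>t. ln (norm (cis t - cis s))"
  \<comment> \<open>Differentiating the product leaves, besides the wanted cosine term, the square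
    of the sine over \<open>2 - 2 * cos (t - s)\<close>, which is
    \<open>(1 + cos (t - s)) / 2\<close>. The second summand removes it.\<close>
  define F where "F = (\<lambda>t. sin (t - s) * ?l t - (t + sin (t - s)) / 2)"
  have cont: "continuous_on {0..2 * pi} (\<lambda>t. sin (t - s) * ?l t)"
  proof -
    have "sin (t - s) * ?l t = Im (cnj (cis s) * ((cis t - cis s) * of_real (?l t)))" for t
      unfolding sin_eq_Im_cis_diff mult.assoc[symmetric] by simp
    then show ?thesis
      by (simp only:) (intro continuous_intros continuous_on_chord_mult_ln)
  qed
  have contF: "continuous_on {0..2 * pi} F"
    unfolding F_def by (rule continuous_on_diff[OF cont]) (auto intro!: continuous_intros)
  have "((\<lambda>t. cos (t - s) * ?l t) has_integral (F (2 * pi) - F 0)) {0..2 * pi}"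
  proof (rule fundamental_theorem_of_calculus_interior_strong[OF finite_cis_eq[of s] _ _ contF])
    fix t assume "t \<in> {0<..<2 * pi} - {t \<in> {0..2 * pi}. cis t = cis s}"
    then have t: "cis t \<noteq> cis s" by auto
    then have c: "1 - cos (t - s) \<noteq> 0" unfolding cis_eq_iff_cos by simp
    have "sin (t - s) * sin (t - s) = (1 - cos (t - s)) * (1 + cos (t - s))"
      using sin_cos_squared_add[of "t - s"] by (simp add: power2_eq_square algebra_simps)
    then have "sin (t - s) * (sin (t - s) / (2 - 2 * cos (t - s))) = (1 + cos (t - s)) / 2"
      using c by (simp add: divide_simps)
    then have eq: "cos (t - s) * ?l t + sin (t - s) / (2 - 2 * cos (t - s)) * sin (t - s)
        - (1 + cos (t - s)) / 2 = cos (t - s) * ?l t"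
      by (simp only: mult.commute[of "sin (t - s)"])
    have "((\<lambda>t. sin (t - s)) has_real_derivative cos (t - s)) (at t)"
      "((\<lambda>t. (t + sin (t - s)) / 2) has_real_derivative (1 + cos (t - s)) / 2) (at t)"
      by (auto intro!: derivative_eq_intros)
    from DERIV_diff[OF DERIV_mult[OF this(1) ln_chord_has_derivative[OF t]] this(2)]
    have "(F has_real_derivative cos (t - s) * ?l t) (at t)"
      unfolding F_def eq .
    then show "(F has_vector_derivative cos (t - s) * ?l t) (at t)"
      by (simp add: has_real_derivative_iff_has_vector_derivative)
  qed simp
  then have "(\<lambda>t. cos (t - s) * ?l t) integrable_on {0..2 * pi}" by blast
  \<comment> \<open>Subtracting from the upper bound 4 makes the integrand nonnegative, and a
    nonnegative gauge integrable function is absolutely integrable.\<close>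
  then have "(\<lambda>t. 4 - cos (t - s) * ?l t) integrable_on {0..2 * pi}"
    by (intro integrable_diff) auto
  moreover have bound: "(1 - cos (t - s)) * ?l t \<ge> - 1" "(1 - cos (t - s)) * ?l t \<le> 6"
    "cos (t - s) * ?l t \<le> 4" for t
  proof -
    define v where "v = 2 - 2 * cos (t - s)"
    have v: "0 \<le> v" "v \<le> 4"
      unfolding v_def using cos_le_one[of "t - s"] cos_ge_minus_one[of "t - s"] by linarith+
    have c: "cos (t - s) = 1 - v / 2" by (simp add: v_def field_simps)
    have l: "?l t = ln v / 2" unfolding ln_norm_cis_diff v_def ..
    \<comment> \<open>With the squared chord \<open>v\<close> in \<open>[0, 4]\<close> everything
      follows from \<open>ln v \<le> v - 1\<close> for \<open>v\<close> and for
      \<open>1 / v\<close>; at \<open>v = 0\<close> the convention \<open>ln 0 = 0\<close> is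
      used.\<close>
    have "- 1 \<le> v * ln v \<and> v * ln v \<le> 12 \<and> ln v \<le> 3"
    proof (cases "v = 0")
      case False
      then have v0: "v > 0" using v by simp
      have up: "ln v \<le> v - 1" using v0 by (rule ln_le_minus_one)
      have "ln (1 / v) \<le> 1 / v - 1" using v0 by (intro ln_le_minus_one) simp
      then have "1 - 1 / v \<le> ln v" using v0 by (simp add: ln_div)
      then have "v * (1 - 1 / v) \<le> v * ln v" using v0 by (intro mult_left_mono) auto
      then have "v - 1 \<le> v * ln v" using v0 by (simp add: right_diff_distrib)
      moreover have "v * ln v \<le> v * 3" using up v v0 by (intro mult_left_mono) auto
      ultimately show ?thesis using up v by auto
    qed simp
    then show "(1 - cos (t - s)) * ?l t \<ge> - 1" "(1 - cos (t - s)) * ?l t \<le> 6" "cos (t - s) * ?l t \<le> 4"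
      unfolding c l by (auto simp: algebra_simps)
  qed
  ultimately have "(\<lambda>t. 4 - cos (t - s) * ?l t) absolutely_integrable_on {0..2 * pi}"
    by (intro nonnegative_absolutely_integrable_1) auto
  then have int: "integrable circle_measure (\<lambda>t. 4 - cos (t - s) * ?l t)"
    by (rule absolutely_integrable_imp_integrable) auto
  have lm: "?l \<in> borel_measurable circle_measure"
  proof -
    have "(\<lambda>t. norm (cis t - cis s)) \<in> borel_measurable circle_measure"
      by (intro continuous_imp_measurable_on_sets_lebesgue continuous_intros) auto
    then show ?thesis by (rule borel_measurable_ln)
  qed
  have const: "integrable circle_measure (\<lambda>t. 10 :: real)"
    by (intro continuous_imp_integrable_real continuous_intros)
  have "integrable circle_measure (\<lambda>t. \<bar>4 - cos (t - s) * ?l t\<bar> + 10)"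
    using int const by (intro Bochner_Integration.integrable_add integrable_abs)
  then show ?thesis
  proof (rule Bochner_Integration.integrable_bound[OF _ lm])
    show "AE t in circle_measure. norm (?l t) \<le> norm (\<bar>4 - cos (t - s) * ?l t\<bar> + 10)"
    proof (rule AE_I2)
      fix t
      have "?l t = (1 - cos (t - s)) * ?l t + cos (t - s) * ?l t" by (simp add: algebra_simps)
      then show "norm (?l t) \<le> norm (\<bar>4 - cos (t - s) * ?l t\<bar> + 10)"
        using bound[of t] unfolding real_norm_def by linarith
    qed
  qed
qed

text \<open>The function \<open>(cis t - cis s) * ln (norm (cis t - cis s)) * cis (- m t)\<close> is
  continuous and takes the same value at both ends, so its derivative integrates to 0. Expanding the
  derivative gives the recursion; the chord times the derivative of its logarithm is
  \<open>\<i> / 2 * (cis t + cis s)\<close>, whence the coefficients of the constant 1.\<close>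

lemma fc_ln_chord_recursion:
  fixes s :: real
  defines "b \<equiv> fc (\<lambda>t. of_real (ln (norm (cis t - cis s))))"
  shows "of_int m * cis s * b m = of_int (m - 1) * b (m - 1)
    - (fc (\<lambda>t. 1) (m - 1) + cis s * fc (\<lambda>t. 1) m) / 2"
proof -
  let ?l = "\<lambda>t. complex_of_real (ln (norm (cis t - cis s)))"
  let ?e = "\<lambda>t. cis (- (of_int m * t))"
  let ?e1 = "\<lambda>t. cis (- (of_int (m - 1) * t))"
  define G where "G = (\<lambda>t. ((cis t - cis s) * ?l t) * ?e t)"
  define G' where "G' = (\<lambda>t. (\<i> * (?l t * ?e1 t) + \<i> / 2 * (1 * ?e1 t) + \<i> / 2 * cis s * (1 * ?e t))
     - \<i> * of_int m * (?l t * ?e1 t) + \<i> * of_int m * cis s * (?l t * ?e t))"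
  have cis1: "cis t * ?e t = ?e1 t" for t by (simp add: cis_mult algebra_simps)
  have "(G' has_integral (G (2 * pi) - G 0)) {0..2 * pi}"
  proof (rule fundamental_theorem_of_calculus_interior_strong[OF finite_cis_eq[of s]])
    show "continuous_on {0..2 * pi} G"
      unfolding G_def by (intro continuous_intros continuous_on_chord_mult_ln)
    fix t assume "t \<in> {0<..<2 * pi} - {t \<in> {0..2 * pi}. cis t = cis s}"
    then have t: "cis t \<noteq> cis s" by auto
    let ?q = "complex_of_real (sin (t - s) / (2 - 2 * cos (t - s)))"
    have d1: "((\<lambda>t. cis t - cis s) has_vector_derivative \<i> * cis t) (at t)"
      using has_vector_derivative_diff[OF cis_has_vector_derivative[of "-1" t] has_vector_derivative_const[of "cis s"]] by simp
    have d2: "(?l has_vector_derivative ?q) (at t)"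
      using ln_chord_has_derivative[OF t]
      by (intro has_vector_derivative_of_real) (simp add: has_real_derivative_iff_has_vector_derivative)
    \<comment> \<open>Numerator and denominator of \<open>?q\<close> both contain the conjugate
      chord, which cancels.\<close>
    have q: "(cis t - cis s) * ?q = \<i> / 2 * (cis t + cis s)"
    proof -
      have u: "cis t * cnj (cis t) = 1" "cis s * cnj (cis s) = 1" by (simp_all add: cis_cnj cis_mult)
      have "complex_of_real (2 - 2 * cos (t - s)) = (cis t - cis s) * cnj (cis t - cis s)"
        unfolding norm_cis_diff_sq[symmetric] complex_norm_square ..
      moreover have "complex_of_real (sin (t - s)) = \<i> / 2 * (cis t + cis s) * cnj (cis t - cis s)"
        by (simp add: complex_eq_iff sin_diff algebra_simps flip: power2_eq_square)
      ultimately show ?thesis using t by simp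
    qed
    have "(G has_vector_derivative (((cis t - cis s) * ?l t) * (- \<i> * of_int m * ?e t)
         + ((cis t - cis s) * ?q + \<i> * cis t * ?l t) * ?e t)) (at t)"
      unfolding G_def by (intro has_vector_derivative_mult d1 d2 cis_has_vector_derivative)
    moreover have "((cis t - cis s) * ?l t) * (- \<i> * of_int m * ?e t)
         + ((cis t - cis s) * ?q + \<i> * cis t * ?l t) * ?e t = G' t"
      unfolding q G'_def cis1[symmetric] by (simp add: algebra_simps)
    ultimately show "(G has_vector_derivative G' t) (at t)" by simp
  qed simp
  moreover have "G (2 * pi) = G 0" unfolding G_def cis_int_mult_two_pi by simp
  ultimately have z: "(G' has_integral 0) {0..2 * pi}" by simp
  have il: "integrable circle_measure ?l" using integrable_ln_chord by (rule integrable_of_real)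
  have i1: "integrable circle_measure (\<lambda>t. 1 :: complex)"
    by (intro continuous_imp_integrable_real continuous_intros)
  let ?c = "2 * complex_of_real pi"
  have "(G' has_integral ((\<i> * (?c * b (m - 1)) + \<i> / 2 * (?c * fc (\<lambda>t. 1) (m - 1)) + \<i> / 2 * cis s * (?c * fc (\<lambda>t. 1) m))
     - \<i> * of_int m * (?c * b (m - 1)) + \<i> * of_int m * cis s * (?c * b m))) {0..2 * pi}"
    unfolding G'_def b_def
    by (intro has_integral_add has_integral_diff has_integral_mult_right fc_has_integral il i1)
  from has_integral_unique[OF z this]
  have "?c * \<i> * ((b (m - 1) + fc (\<lambda>t. 1) (m - 1) / 2 + cis s * fc (\<lambda>t. 1) m / 2)
     - of_int m * b (m - 1) + of_int m * cis s * b m) = 0"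
    by (simp add: algebra_simps)
  then have "b (m - 1) + fc (\<lambda>t. 1) (m - 1) / 2 + cis s * fc (\<lambda>t. 1) m / 2
     - of_int m * b (m - 1) + of_int m * cis s * b m = 0"
    by simp
  then show ?thesis by (simp add: algebra_simps add_divide_distrib add_eq_0_iff2)
qed

text \<open>At \<open>m = 1\<close> the recursion multiplies the coefficient of index 0 by 0, so it
  starts by itself. For larger \<open>m\<close> the coefficients of the constant vanish, and the
  coefficient at \<open>m\<close> is \<open>- (cnj (cis s) ^ m) / (2 * m)\<close>.\<close>

lemma log_symbol_ln_chord: "log_symbol (\<lambda>t. of_real (ln (norm (cis t - cis s))))"
proof (rule log_symbol_of_real[OF integrable_ln_chord])
  let ?b = "fc (\<lambda>t. of_real (ln (norm (cis t - cis s))))"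
  have "of_nat (Suc m) * ?b (int (Suc m)) = - (cnj (cis s) ^ Suc m) / 2" for m
  proof (induction m)
    case 0
    have "cis s * ?b 1 = - 1 / 2"
      using fc_ln_chord_recursion[of 1 s] by (simp add: fc_const_1)
    then have "cnj (cis s) * (cis s * ?b 1) = cnj (cis s) * (- 1 / 2)" by simp
    then show ?case by (simp add: cis_cnj cis_mult flip: mult.assoc)
  next
    case (Suc m)
    have "of_nat (Suc (Suc m)) * cis s * ?b (int (Suc (Suc m))) = of_nat (Suc m) * ?b (int (Suc m))"
      using fc_ln_chord_recursion[of "int (Suc (Suc m))" s] by (simp add: fc_const_1)
    then have "cnj (cis s) * (of_nat (Suc (Suc m)) * cis s * ?b (int (Suc (Suc m)))) =
      cnj (cis s) * (- (cnj (cis s) ^ Suc m) / 2)" using Suc by simp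
    moreover have "cnj (cis s) * (of_nat (Suc (Suc m)) * cis s * ?b (int (Suc (Suc m)))) =
      (cnj (cis s) * cis s) * (of_nat (Suc (Suc m)) * ?b (int (Suc (Suc m))))" by (simp only: mult_ac)
    moreover have "cnj (cis s) * cis s = 1" by (simp add: cis_cnj cis_mult)
    ultimately show ?case by (simp only: mult_1) simp
  qed
  then have b: "of_nat m * ?b (int m) = - (cnj (cis s) ^ m) / 2" if "m \<ge> 1" for m
    using that by (cases m) auto
  show "log_approx (\<lambda>m. ?b (int m))"
  proof (rule log_approx_unit_power_over[of "cnj (cis s)" _ "- 1 / 2"])
    fix m :: nat assume m: "m \<ge> 1"
    then show "?b (int m) = - 1 / 2 * (cnj (cis s) ^ m / of_nat m)"
      using b[OF m] by (simp add: field_simps)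
  qed simp
qed

section \<open>Piecewise holomorphic symbols\<close>

text \<open>Up to a factor of modulus \<open>2 * pi\<close> the coefficient is the contour integral
  of \<open>g z * z powi (- k - 1)\<close> over the unit circle. Moving the contour radially to
  radius \<open>R\<close> and estimating there gives the bound, for \<open>R\<close> on either side
  of 1.\<close>

lemma fc_holomorphic_bound:
  assumes U: "open U" "g holomorphic_on U" and R: "R > 0"
    and seg: "\<And>z. norm z = 1 \<Longrightarrow> closed_segment z (of_real R * z) \<subseteq> U - {0}"
  obtains M where "\<And>k. norm (fc (\<lambda>t. g (cis t)) k) \<le> M * R powi (- k)"
proof -
  have sph: "z \<in> U" "z \<noteq> 0" if "norm z = 1 \<or> norm z = R" for z
  proof -
    have "z \<in> U - {0}"
    proof (cases "norm z = 1")
      case True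
      then show ?thesis using seg[of z] by auto
    next
      case False
      then have "norm (z / of_real R) = 1" "of_real R * (z / of_real R) = z"
        using that R by (auto simp: norm_divide)
      then show ?thesis using seg[of "z / of_real R"] by (metis ends_in_segment(2) subsetD)
    qed
    then show "z \<in> U" "z \<noteq> 0" by auto
  qed
  have contg: "continuous_on U g" using U(2) by (rule holomorphic_on_imp_continuous_on)
  have "compact (g ` sphere 0 R)"
    using sph by (intro compact_continuous_image continuous_on_subset[OF contg]) auto
  then have "bounded (g ` sphere 0 R)" by (rule compact_imp_bounded)
  then obtain M where M: "\<And>z. norm z = R \<Longrightarrow> norm (g z) \<le> M"
    unfolding bounded_iff by (metis imageI mem_sphere_0)
  have "norm (g (of_real R)) \<le> M" using R by (intro M) simp
  then have "M \<ge> 0" by (rule order_trans[OF norm_ge_zero])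
  have gint: "integrable circle_measure (\<lambda>t. g (cis t))"
    using sph by (intro continuous_imp_integrable_real continuous_on_compose2[OF contg] continuous_intros) auto
  have "norm (fc (\<lambda>t. g (cis t)) k) \<le> M * R powi (- k)" for k
  proof -
    define G where "G = (\<lambda>z. g z * z powi (- k - 1))"
    have hol: "G holomorphic_on (U - {0})"
      unfolding G_def using U(2) by (intro holomorphic_intros) (auto intro: holomorphic_on_subset)
    have "open (U - {0})" using U(1) by (rule open_delete)
    have hom: "homotopic_loops (U - {0}) (circlepath 0 1) (circlepath 0 R)"
    proof (rule homotopic_loops_linear)
      fix t :: real
      have "circlepath 0 R t = of_real R * circlepath 0 1 t" by (simp add: circlepath)
      moreover have "norm (circlepath 0 1 t) = 1" by (simp add: circlepath)
      ultimately show "closed_segment (circlepath 0 1 t) (circlepath 0 R t) \<subseteq> U - {0}"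
        using seg by metis
    qed auto
    have img: "path_image (circlepath 0 R) \<subseteq> U - {0}" "path_image (circlepath 0 1) \<subseteq> U - {0}"
      using sph R by auto
    have "contour_integral (circlepath 0 1) G = contour_integral (circlepath 0 R) G"
      using Cauchy_theorem_homotopic_loops[OF hom \<open>open (U - {0})\<close> hol] by simp
    moreover have "G contour_integrable_on (circlepath 0 1)" "G contour_integrable_on (circlepath 0 R)"
      using contour_integrable_holomorphic_simple[OF hol \<open>open (U - {0})\<close>] img by auto
    ultimately have c1: "(G has_contour_integral contour_integral (circlepath 0 R) G) (circlepath 0 1)"
      and cR: "(G has_contour_integral contour_integral (circlepath 0 R) G) (circlepath 0 R)"
      using has_contour_integral_integral by metis+
    let ?I = "contour_integral (circlepath 0 R) G"
    have cis: "G (0 + of_real 1 * cis t) * of_real 1 * \<i> * cis t = \<i> * (g (cis t) * cis (- (of_int k * t)))" for t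
    proof -
      have "cis t powi (- k - 1) * cis t = cis (- (of_int k * t))"
        by (simp add: cis_power_int cis_mult algebra_simps)
      then show ?thesis by (simp add: G_def mult_ac)
    qed
    have "((\<lambda>t. \<i> * (g (cis t) * cis (- (of_int k * t)))) has_integral ?I) {0..2 * pi}"
      using c1 unfolding circlepath_def by (subst (asm) has_contour_integral_part_circlepath_iff) (simp_all only: cis, simp)
    moreover have "((\<lambda>t. \<i> * (g (cis t) * cis (- (of_int k * t)))) has_integral
        (\<i> * (2 * of_real pi * fc (\<lambda>t. g (cis t)) k))) {0..2 * pi}"
      by (intro has_integral_mult_right fc_has_integral gint)
    ultimately have "?I = \<i> * (2 * of_real pi * fc (\<lambda>t. g (cis t)) k)" by (rule has_integral_unique)
    then have nI: "norm ?I = 2 * pi * norm (fc (\<lambda>t. g (cis t)) k)" by (simp add: norm_mult)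
    have "norm ?I \<le> (M * R powi (- k - 1)) * (2 * pi * R)"
    proof (rule has_contour_integral_bound_circlepath[OF cR])
      fix z :: complex assume "norm (z - 0) = R"
      then have z: "norm z = R" by simp
      then show "norm (G z) \<le> M * R powi (- k - 1)"
        using M[OF z] R unfolding G_def by (simp add: norm_mult norm_power_int mult_right_mono)
    qed (use R \<open>M \<ge> 0\<close> in auto)
    also have "\<dots> = 2 * pi * (M * R powi (- k))"
      using R by (simp add: power_int_diff)
    finally show ?thesis unfolding nI by simp
  qed
  then show thesis using that by blast
qed

text \<open>A radius slightly above 1 gives the decay at positive indices, one slightly below 1 that
  at negative indices.\<close>

lemma log_symbol_holomorphic:
  assumes U: "open U" "sphere 0 1 \<subseteq> U" "g holomorphic_on U"
  shows "log_symbol (\<lambda>t. g (cis t))"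
proof -
  have "compact (sphere (0::complex) 1)" by simp
  then obtain \<epsilon> where eps: "\<epsilon> > 0" "(\<Union>x\<in>sphere 0 1. ball x \<epsilon>) \<subseteq> U"
    using compact_subset_open_imp_ball_epsilon_subset U(1,2) by metis
  \<comment> \<open>Below \<epsilon> the radial segments stay in \<open>U\<close>; below 1 they
    avoid the origin.\<close>
  define e where "e = min \<epsilon> 1 / 2"
  have e: "0 < e" "e < \<epsilon>" "e < 1" using eps(1) by (auto simp: e_def)
  have seg: "closed_segment z (of_real R * z) \<subseteq> U - {0}" if z: "norm z = 1" and R: "\<bar>R - 1\<bar> \<le> e" for z :: complex and R
  proof
    fix w assume "w \<in> closed_segment z (of_real R * z)"
    then obtain u where u: "0 \<le> u" "u \<le> 1" "w = (1 - u) *\<^sub>R z + u *\<^sub>R (of_real R * z)"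
      by (auto simp: in_segment)
    then have "w - z = of_real (u * (R - 1)) * z" by (simp add: scaleR_conv_of_real algebra_simps)
    then have "norm (w - z) = u * \<bar>R - 1\<bar>"
      using z u by (simp add: norm_mult abs_mult del: of_real_mult of_real_diff)
    also have "\<dots> \<le> 1 * e" using u R by (intro mult_mono) auto
    finally have "norm (w - z) \<le> e" by simp
    then have "w \<in> ball z \<epsilon>" "w \<noteq> 0" using e z by (auto simp: dist_norm norm_minus_commute)
    moreover have "z \<in> sphere 0 1" using z by simp
    ultimately show "w \<in> U - {0}" using eps(2) by blast
  qed
  have bound: "\<exists>M. \<forall>k. norm (fc (\<lambda>t. g (cis t)) k) \<le> M * R powi (- k)" if "R > 0" "\<bar>R - 1\<bar> \<le> e" for R
    using fc_holomorphic_bound[OF U(1,3) that(1) seg[OF _ that(2)]] by metis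
  obtain M where M: "\<And>k. norm (fc (\<lambda>t. g (cis t)) k) \<le> M * (1 + e) powi (- k)"
    using bound[of "1 + e"] e by auto
  obtain M' where M': "\<And>k. norm (fc (\<lambda>t. g (cis t)) k) \<le> M' * (1 - e) powi (- k)"
    using bound[of "1 - e"] e by auto
  have "log_approx (\<lambda>m. fc (\<lambda>t. g (cis t)) (int m))"
  proof (rule log_approx_exp_decay)
    show "0 < inverse (1 + e)" "inverse (1 + e) < 1" using e by (simp_all add: inverse_less_1_iff)
    show "norm (fc (\<lambda>t. g (cis t)) (int m)) \<le> M * inverse (1 + e) ^ m" for m
      using M[of "int m"] by (simp add: power_int_minus power_inverse)
  qed
  moreover have "log_approx (\<lambda>m. fc (\<lambda>t. g (cis t)) (- int m))"
  proof (rule log_approx_exp_decay)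
    show "0 < 1 - e" "1 - e < 1" using e by simp_all
    show "norm (fc (\<lambda>t. g (cis t)) (- int m)) \<le> M' * (1 - e) ^ m" for m
      using M'[of "- int m"] by simp
  qed
  moreover have "integrable circle_measure (\<lambda>t. g (cis t))"
  proof (rule continuous_imp_integrable_real)
    have "continuous_on {0..2 * pi} cis" by (intro continuous_intros)
    moreover have "cis ` {0..2 * pi} \<subseteq> U" using U(2) by auto
    ultimately show "continuous_on {0..2 * pi} (\<lambda>t. g (cis t))"
      using continuous_on_compose2[OF holomorphic_on_imp_continuous_on[OF U(3)]] by blast
  qed
  ultimately show ?thesis unfolding log_symbol_def by blast
qed

section \<open>Determinations of the logarithm along the circle\<close>

lemma Ln_polar:
  assumes "r > 0"
  shows "Ln (of_real r * cis a) = of_real (ln r) + \<i> * of_real (a - 2 * pi * of_int \<lceil>(a - pi) / (2 * pi)\<rceil>)"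
proof -
  \<comment> \<open>The number of turns that brings the angle into the half-open range
    \<open>(- pi, pi]\<close> of the principal logarithm.\<close>
  define n where "n = \<lceil>(a - pi) / (2 * pi)\<rceil>"
  have n: "of_int n - 1 < (a - pi) / (2 * pi)" "(a - pi) / (2 * pi) \<le> of_int n"
    unfolding n_def by linarith+
  let ?z = "complex_of_real (ln r) + \<i> * of_real (a - 2 * pi * of_int n)"
  have "- pi < Im ?z" "Im ?z \<le> pi"
    using n pi_gt_zero by (auto simp: field_simps)
  then have "Ln (exp ?z) = ?z" by (rule Ln_exp)
  moreover have "exp ?z = of_real r * cis a"
  proof -
    have "exp ?z = exp (complex_of_real (ln r)) * cis (a - 2 * pi * of_int n)"
      by (simp only: exp_add cis_conv_exp)
    also have "cis (a - 2 * pi * of_int n) = cis a"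
      by (simp only: complex_eq_iff cis.sel cos_diff sin_diff cos_int_2pin sin_int_2pin) simp
    also have "exp (complex_of_real (ln r)) = of_real r" using assms by (simp only: exp_of_real exp_ln)
    finally show ?thesis .
  qed
  ultimately show ?thesis unfolding n_def by simp
qed

lemma log_branch_polar:
  assumes "r > 0" "w = of_real r * cis a"
  shows "log_branch \<theta> w = of_real (ln (norm w)) + \<i> * of_real (a - 2 * pi * of_int \<lceil>(a - \<theta> - pi) / (2 * pi)\<rceil>)"
proof -
  have "w * cis (- \<theta>) = of_real r * cis (a - \<theta>)" using assms(2) by (simp add: cis_mult mult.assoc)
  moreover have "norm w = r" using assms by (simp add: norm_mult)
  ultimately show ?thesis using Ln_polar[OF assms(1), of "a - \<theta>"]
    by (simp add: log_branch_def algebra_simps)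
qed

text \<open>Over the interval the affine argument grows by one half only, so that its ceiling jumps
  at most once; \<tau> beyond \<open>2 * pi\<close> means no jump.\<close>

lemma ceiling_affine_step:
  obtains n :: int and \<tau> :: real where
    "\<And>t. 0 \<le> t \<Longrightarrow> t \<le> 2 * pi \<Longrightarrow> \<lceil>(t + \<beta>) / (4 * pi)\<rceil> = n + (if t > \<tau> then 1 else 0)"
proof -
  define n where "n = \<lceil>\<beta> / (4 * pi)\<rceil>"
  have n: "of_int n - 1 < \<beta> / (4 * pi)" "\<beta> / (4 * pi) \<le> of_int n"
    unfolding n_def by linarith+
  then have n': "4 * pi * of_int n - 4 * pi < \<beta>" "\<beta> \<le> 4 * pi * of_int n"
    by (auto simp: field_simps)
  have "\<lceil>(t + \<beta>) / (4 * pi)\<rceil> = n + (if t > 4 * pi * of_int n - \<beta> then 1 else 0)"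
    if "0 \<le> t" "t \<le> 2 * pi" for t
  proof (rule ceiling_unique)
    show "of_int (n + (if t > 4 * pi * of_int n - \<beta> then 1 else 0)) - 1 < (t + \<beta>) / (4 * pi)"
      using n' that pi_gt_zero by (simp add: pos_less_divide_eq) (simp add: algebra_simps)
    show "(t + \<beta>) / (4 * pi) \<le> of_int (n + (if t > 4 * pi * of_int n - \<beta> then 1 else 0))"
      using n' that pi_gt_zero by (simp add: pos_divide_le_eq) (simp add: algebra_simps)
  qed
  then show thesis by (rule that)
qed

text \<open>For angles in \<open>[0, 2 * pi]\<close> the first form has a nonnegative radial factor
  when \<open>t \<ge> s\<close>, the second when \<open>t \<le> s\<close>.\<close>

lemma cis_diff_polar:
  "cis t - cis s = of_real (2 * sin ((t - s) / 2)) * cis ((t + s + pi) / 2)"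
  "cis t - cis s = of_real (2 * sin ((s - t) / 2)) * cis ((t + s - pi) / 2)"
proof -
  have *: "cis ((t + s + pi) / 2) = \<i> * cis ((t + s) / 2)" "cis ((t + s - pi) / 2) = - \<i> * cis ((t + s) / 2)"
    by (simp_all add: complex_eq_iff add_divide_distrib diff_divide_distrib cos_add sin_add cos_diff sin_diff)
  have "(s - t) / 2 = - ((t - s) / 2)" by (simp add: field_simps)
  then have m: "sin ((s - t) / 2) = - sin ((t - s) / 2)" by (simp only: sin_minus)
  show "cis t - cis s = of_real (2 * sin ((t - s) / 2)) * cis ((t + s + pi) / 2)"
    unfolding * using m by (simp add: complex_eq_iff cos_diff_cos sin_diff_sin)
  then show "cis t - cis s = of_real (2 * sin ((s - t) / 2)) * cis ((t + s - pi) / 2)"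
    unfolding * m by simp
qed

text \<open>The argument of \<open>cis t - cis s\<close> is affine in \<open>t\<close> with slope \<open>1 / 2\<close> on both sides of
  \<open>s\<close>, so that a determination of its logarithm is, apart from \<open>ln\<close> of the chord, the sum
  of an affine function and of finitely many steps.\<close>

lemma log_branch_chord_symbol:
  assumes s: "0 \<le> s" "s \<le> 2 * pi"
  obtains u where "log_symbol u"
    "\<And>t. 0 \<le> t \<Longrightarrow> t \<le> 2 * pi \<Longrightarrow> cis t \<noteq> cis s \<Longrightarrow> log_branch \<theta> (cis t - cis s) = u t"
proof -
  define H where "H = (\<lambda>\<tau> t::real. complex_of_real (if t > \<tau> then 1 else 0))"
  obtain n1 \<tau>1 where n1: "\<And>t. 0 \<le> t \<Longrightarrow> t \<le> 2 * pi \<Longrightarrow>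
      \<lceil>(t + (s - pi - 2 * \<theta>)) / (4 * pi)\<rceil> = n1 + (if t > \<tau>1 then 1 else 0)"
    using ceiling_affine_step by metis
  obtain n2 \<tau>2 where n2: "\<And>t. 0 \<le> t \<Longrightarrow> t \<le> 2 * pi \<Longrightarrow>
      \<lceil>(t + (s - 3 * pi - 2 * \<theta>)) / (4 * pi)\<rceil> = n2 + (if t > \<tau>2 then 1 else 0)"
    using ceiling_affine_step by metis
  define c1 where "c1 = \<i> * of_real ((s + pi) / 2 - 2 * pi * of_int n1)"
  define c2 where "c2 = \<i> * of_real ((s - pi) / 2 - 2 * pi * of_int n2)"
  define d where "d = - 2 * of_real pi * \<i>"
  \<comment> \<open>To the left of \<open>s\<close> the constant is \<open>c2\<close> with a jump at
    \<open>\<tau>2\<close>, to the right \<open>c1\<close> with a jump at \<open>\<tau>1\<close>.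
    The step at \<open>s\<close> changes the constant, and those at the maxima, being products with
    that step, exchange the jumps only beyond \<open>s\<close>.\<close>
  define u where "u = (\<lambda>t. of_real (ln (norm (cis t - cis s))) + (\<i> / 2 * of_real t + (c2 +
     (d * H \<tau>2 t + ((c1 - c2) * H s t + (d * H (max \<tau>1 s) t + (- d) * H (max \<tau>2 s) t))))))"
  have "log_symbol u"
    unfolding u_def H_def
    by (intro log_symbol_add log_symbol_scale log_symbol_ln_chord log_symbol_id log_symbol_const log_symbol_step)
  moreover have "log_branch \<theta> (cis t - cis s) = u t"
    if t: "0 \<le> t" "t \<le> 2 * pi" "cis t \<noteq> cis s" for t
  proof (cases "t > s")
    case True
    then have "(t - s) / 2 > 0" "(t - s) / 2 \<le> pi" using t s by auto
    moreover have "sin ((t - s) / 2) \<noteq> 0" using cis_diff_polar(1)[of t s] t(3) by auto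
    ultimately have pos: "2 * sin ((t - s) / 2) > 0"
      using sin_ge_zero[of "(t - s) / 2"] by simp
    have arg: "((t + s + pi) / 2 - \<theta> - pi) / (2 * pi) = (t + (s - pi - 2 * \<theta>)) / (4 * pi)"
      by (simp add: field_simps)
    show ?thesis
      unfolding log_branch_polar[OF pos cis_diff_polar(1)] arg n1[OF t(1,2)] u_def c1_def c2_def d_def H_def
      using True by (simp add: max_def) (simp add: algebra_simps add_divide_distrib)
  next
    case False
    then have "t < s" using t(3) by (cases "t = s") auto
    then have "(s - t) / 2 > 0" "(s - t) / 2 \<le> pi" using t s by auto
    moreover have "sin ((s - t) / 2) \<noteq> 0" using cis_diff_polar(2)[of t s] t(3) by auto
    ultimately have pos: "2 * sin ((s - t) / 2) > 0"
      using sin_ge_zero[of "(s - t) / 2"] by simp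
    have arg: "((t + s - pi) / 2 - \<theta> - pi) / (2 * pi) = (t + (s - 3 * pi - 2 * \<theta>)) / (4 * pi)"
      by (simp add: field_simps)
    show ?thesis
      unfolding log_branch_polar[OF pos cis_diff_polar(2)] arg n2[OF t(1,2)] u_def c1_def c2_def d_def H_def
      using \<open>t < s\<close> by (simp add: max_def) (simp add: algebra_simps add_divide_distrib diff_divide_distrib)
  qed
  ultimately show thesis by (rule that)
qed

lemma log_symbol_log_sing_circle:
  assumes "f \<in> log_sing_circle"
  shows "log_symbol (\<lambda>t. f (cis t))"
proof -
  from assms have fm: "(\<lambda>t. f (cis t)) \<in> borel_measurable circle_measure"
    by (simp add: log_sing_circle_def Linf_circle_def)
  from assms obtain g U and p q :: nat and \<alpha> :: "nat \<Rightarrow> nat \<Rightarrow> complex" and \<zeta> :: "nat \<Rightarrow> complex" and \<theta> :: "nat \<Rightarrow> real"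
    where g: "open U" "sphere 0 1 \<subseteq> U" "g holomorphic_on U"
    and \<zeta>: "\<forall>h\<le>q. \<zeta> h \<in> sphere 0 1"
    and ae: "AE t in circle_measure. f (cis t) = g (cis t) +
               (\<Sum>k\<le>p. \<Sum>h\<le>q. \<alpha> k h * (cis t - \<zeta> h) ^ k * log_branch (\<theta> h) (cis t - \<zeta> h))"
    unfolding log_sing_circle_def by blast
  have "\<exists>s u. 0 \<le> s \<and> s \<le> 2 * pi \<and> \<zeta> h = cis s \<and> log_symbol u \<and>
     (\<forall>t. 0 \<le> t \<longrightarrow> t \<le> 2 * pi \<longrightarrow> cis t \<noteq> cis s \<longrightarrow> log_branch (\<theta> h) (cis t - cis s) = u t)" if "h \<le> q" for h
  proof -
    have "norm (\<zeta> h) = 1" using \<zeta> that by auto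
    then have z: "\<zeta> h = cis (Arg2pi (\<zeta> h))" using Arg2pi_eq[of "\<zeta> h"] by (simp add: cis_conv_exp)
    have s: "0 \<le> Arg2pi (\<zeta> h)" "Arg2pi (\<zeta> h) \<le> 2 * pi"
      using Arg2pi_ge_0[of "\<zeta> h"] Arg2pi_lt_2pi[of "\<zeta> h"] by auto
    obtain u where "log_symbol u"
      "\<And>t. 0 \<le> t \<Longrightarrow> t \<le> 2 * pi \<Longrightarrow> cis t \<noteq> cis (Arg2pi (\<zeta> h)) \<Longrightarrow> log_branch (\<theta> h) (cis t - cis (Arg2pi (\<zeta> h))) = u t"
      using log_branch_chord_symbol[OF s, of "\<theta> h"] by blast
    then show ?thesis using s z by blast
  qed
  then obtain s u where su: "\<And>h. h \<le> q \<Longrightarrow> \<zeta> h = cis (s h)" "\<And>h. h \<le> q \<Longrightarrow> log_symbol (u h)"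
    "\<And>h t. h \<le> q \<Longrightarrow> 0 \<le> t \<Longrightarrow> t \<le> 2 * pi \<Longrightarrow> cis t \<noteq> cis (s h) \<Longrightarrow> log_branch (\<theta> h) (cis t - cis (s h)) = u h t"
    by metis
  \<comment> \<open>The logarithms are represented by \<open>u h\<close> only away from their
    singularities, which form a null set.\<close>
  let ?F = "\<Union>h\<le>q. {t \<in> {0..2 * pi}. cis t = cis (s h)}"
  have "finite ?F" using finite_cis_eq by blast
  then have "?F \<in> null_sets lebesgue" by (simp add: negligible_finite flip: negligible_iff_null_sets)
  then have "AE t in lebesgue. t \<notin> ?F" by (rule AE_not_in)
  then have "AE t in circle_measure. t \<notin> ?F"
    by (subst AE_restrict_space_iff) (auto elim: eventually_mono)
  moreover have "AE t in circle_measure. t \<in> {0..2 * pi}"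
    by (rule AE_I2) (simp add: space_restrict_space)
  ultimately have "AE t in circle_measure. g (cis t) +
      (\<Sum>k\<le>p. \<Sum>h\<le>q. \<alpha> k h * ((cis t - cis (s h)) ^ k * u h t)) = f (cis t)"
    using ae
  proof eventually_elim
    case (elim t)
    have "(\<Sum>k\<le>p. \<Sum>h\<le>q. \<alpha> k h * (cis t - \<zeta> h) ^ k * log_branch (\<theta> h) (cis t - \<zeta> h)) =
      (\<Sum>k\<le>p. \<Sum>h\<le>q. \<alpha> k h * ((cis t - cis (s h)) ^ k * u h t))"
      using elim(1,2) su(1,3) by (intro sum.cong refl) (auto simp: mult.assoc)
    then show ?case using elim(3) by simp
  qed
  moreover have "log_symbol (\<lambda>t. g (cis t) +
      (\<Sum>k\<le>p. \<Sum>h\<le>q. \<alpha> k h * ((cis t - cis (s h)) ^ k * u h t)))"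
    using su(2) g by (intro log_symbol_add log_symbol_sum log_symbol_scale log_symbol_mult_power
      log_symbol_holomorphic) auto
  ultimately show ?thesis using fm log_symbol_cong_AE by blast
qed

section \<open>Approximation of Toeplitz matrices\<close>

definition toeplitz_mat :: "nat \<Rightarrow> (int \<Rightarrow> complex) \<Rightarrow> complex mat" where
  "toeplitz_mat n a = Matrix.mat n n (\<lambda>(i, j). a (int i - int j))"

lemma toeplitz_eq: "toeplitz n f = toeplitz_mat n (fc (\<lambda>t. f (cis t)))"
  by (simp add: toeplitz_def toeplitz_mat_def fourier_coeff_def fc_def)

lemma chebyshev_norm_le_iff:
  assumes "A \<in> carrier_mat n n" "n \<ge> 1"
  shows "chebyshev_norm A \<le> c \<longleftrightarrow> (\<forall>i<n. \<forall>j<n. norm (A $$ (i, j)) \<le> c)"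
proof -
  have e: "elements_mat A = (\<lambda>(i, j). A $$ (i, j)) ` ({..<n} \<times> {..<n})"
  proof (intro equalityI subsetI)
    fix x assume "x \<in> elements_mat A"
    then show "x \<in> (\<lambda>(i, j). A $$ (i, j)) ` ({..<n} \<times> {..<n})"
      using assms(1) by (auto dest!: elements_matD)
  next
    fix x assume "x \<in> (\<lambda>(i, j). A $$ (i, j)) ` ({..<n} \<times> {..<n})"
    then show "x \<in> elements_mat A" using elements_matI[OF assms(1)] by auto
  qed
  have "{..<n} \<times> {..<n} \<noteq> {}" using assms(2) by (auto simp: lessThan_empty_iff)
  then have "chebyshev_norm A \<le> c \<longleftrightarrow> (\<forall>x \<in> norm ` elements_mat A. x \<le> c)"
    unfolding chebyshev_norm_def e by (intro Max_le_iff) auto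
  then show ?thesis unfolding e by auto
qed

lemma norm_entry_le_chebyshev_norm:
  assumes "A \<in> carrier_mat n n" "i < n" "j < n"
  shows "norm (A $$ (i, j)) \<le> chebyshev_norm A"
proof -
  have "n \<ge> 1" using assms(2) by simp
  then show ?thesis using chebyshev_norm_le_iff[OF assms(1), of "chebyshev_norm A"] assms(2,3) by blast
qed

text \<open>Take a nonzero coefficient whose index \<open>k\<close> has least modulus: either
  \<open>k\<close> does not occur in the matrix, which is then zero, or \<open>a k\<close> is one of
  its entries. This converts absolute errors into relative ones uniformly in
  \<open>n\<close>.\<close>

lemma toeplitz_mat_chebyshev_gap:
  obtains \<delta> where "0 < \<delta>" "\<delta> \<le> 1"
    "\<And>n. n \<ge> 1 \<Longrightarrow> (\<forall>i<n. \<forall>j<n. a (int i - int j) = 0) \<or> \<delta> \<le> chebyshev_norm (toeplitz_mat n a)"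
proof (cases "\<forall>k. a k = 0")
  case True
  then show ?thesis using that[of 1] by auto
next
  case False
  then obtain k where "a k \<noteq> 0" by blast
  from ex_has_least_nat[of "\<lambda>k. a k \<noteq> 0", OF this, of "\<lambda>k. nat \<bar>k\<bar>"]
  obtain k where k: "a k \<noteq> 0" "\<And>l. a l \<noteq> 0 \<Longrightarrow> nat \<bar>k\<bar> \<le> nat \<bar>l\<bar>" by blast
  show ?thesis
  proof (rule that[of "min 1 (norm (a k))"])
    fix n :: nat assume n: "n \<ge> 1"
    show "(\<forall>i<n. \<forall>j<n. a (int i - int j) = 0) \<or> min 1 (norm (a k)) \<le> chebyshev_norm (toeplitz_mat n a)"
    proof (cases "n \<le> nat \<bar>k\<bar>")
      case True
      have "a (int i - int j) = 0" if "i < n" "j < n" for i j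
      proof (rule ccontr)
        assume "a (int i - int j) \<noteq> 0"
        then have "nat \<bar>k\<bar> \<le> nat \<bar>int i - int j\<bar>" by (rule k(2))
        then show False using True that by linarith
      qed
      then show ?thesis by blast
    next
      case False
      then have ij: "nat k < n" "nat (- k) < n" "int (nat k) - int (nat (- k)) = k" by linarith+
      have "norm (toeplitz_mat n a $$ (nat k, nat (- k))) \<le> chebyshev_norm (toeplitz_mat n a)"
        using ij(1,2) by (intro norm_entry_le_chebyshev_norm) (auto simp: toeplitz_mat_def)
      then show ?thesis using ij by (simp add: toeplitz_mat_def min.coboundedI2)
    qed
  qed (use k in auto)
qed

lemma norm_fc_le:
  assumes "integrable circle_measure u"
  shows "norm (fc u k) \<le> (LINT t|circle_measure. norm (u t)) / (2 * pi)"
proof -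
  have "norm (LINT t|circle_measure. u t * cis (- (of_int k * t))) \<le>
      (LINT t|circle_measure. norm (u t * cis (- (of_int k * t))))"
    by (rule integral_norm_bound)
  then show ?thesis by (simp add: fc_def norm_divide norm_mult divide_right_mono)
qed

lemma fc_Re:
  assumes "integrable circle_measure u"
  shows "fc (\<lambda>t. of_real (Re (u t))) k = (fc u k + cnj (fc u (- k))) / 2"
proof -
  have "integrable circle_measure (\<lambda>t. cnj (u t))"
    using assms by (rule integrable_bounded_linear[OF bounded_linear_cnj])
  then have "fc (\<lambda>t. u t + cnj (u t)) k = fc u k + cnj (fc u (- k))"
    using assms by (simp only: fc_add fc_cnj)
  moreover have "(\<lambda>t. of_real (Re (u t))) = (\<lambda>t. (1 / 2) * (u t + cnj (u t)))"
    by (simp add: complex_add_cnj)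
  ultimately show ?thesis by (simp only: fc_scale) simp
qed

text \<open>The numbers of nodes come from the coefficient sequences and \<eta> alone, so that
  \<open>B\<close> is the same for all \<open>n\<close>.\<close>

lemma toeplitz_circulant_low_rank_approx:
  assumes "norm \<phi> = 1" "log_symbol u"
  obtains B where "B \<ge> 0"
    "\<And>\<eta> n. 0 < \<eta> \<Longrightarrow> \<eta> < 1 \<Longrightarrow> \<exists>p R. R \<in> carrier_mat n n \<and>
       real (vec_space.rank n R) \<le> B * (1 + ln (1 / \<eta>))\<^sup>2 \<and>
       (\<forall>i<n. \<forall>j<n. norm (fc u (int i - int j) - circ n \<phi> p i j - R $$ (i, j)) \<le> \<eta>)"
proof -
  obtain B where B: "B \<ge> 0"
    "\<And>\<eta>. 0 < \<eta> \<Longrightarrow> \<eta> < 1 \<Longrightarrow> \<exists>S. real S \<le> B * (1 + ln (1 / \<eta>))\<^sup>2 \<and> exp_approx \<eta> S (\<lambda>m. fc u (int m))"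
    using assms(2) log_approxE unfolding log_symbol_def by metis
  obtain B' where B': "B' \<ge> 0"
    "\<And>\<eta>. 0 < \<eta> \<Longrightarrow> \<eta> < 1 \<Longrightarrow> \<exists>S. real S \<le> B' * (1 + ln (1 / \<eta>))\<^sup>2 \<and> exp_approx \<eta> S (\<lambda>m. fc u (- int m))"
    using assms(2) log_approxE unfolding log_symbol_def by metis
  have "\<exists>p R. R \<in> carrier_mat n n \<and>
       real (vec_space.rank n R) \<le> (B + B') * (1 + ln (1 / \<eta>))\<^sup>2 \<and>
       (\<forall>i<n. \<forall>j<n. norm (fc u (int i - int j) - circ n \<phi> p i j - R $$ (i, j)) \<le> \<eta>)"
    if \<eta>: "0 < \<eta>" "\<eta> < 1" for \<eta> n
  proof -
    obtain S where S: "real S \<le> B * (1 + ln (1 / \<eta>))\<^sup>2" "exp_approx \<eta> S (\<lambda>m. fc u (int m))"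
      using B(2)[OF \<eta>] by blast
    obtain S' where S': "real S' \<le> B' * (1 + ln (1 / \<eta>))\<^sup>2" "exp_approx \<eta> S' (\<lambda>m. fc u (- int m))"
      using B'(2)[OF \<eta>] by blast
    obtain M v where M: "finite M" "card M \<le> S" "\<And>r. r \<in> M \<Longrightarrow> r \<noteq> 0 \<and> norm r < 1"
      and v: "\<And>m. m \<ge> 1 \<Longrightarrow> norm (fc u (int m) - (\<Sum>r\<in>M. v r * r ^ m)) \<le> \<eta>"
      using exp_approxE[OF S(2)] by metis
    obtain N w where N: "finite N" "card N \<le> S'" "\<And>r. r \<in> N \<Longrightarrow> r \<noteq> 0 \<and> norm r < 1"
      and w: "\<And>m. m \<ge> 1 \<Longrightarrow> norm (fc u (- int m) - (\<Sum>r\<in>N. w r * r ^ m)) \<le> \<eta>"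
      using exp_approxE[OF S'(2)] by metis
    obtain p R where R: "R \<in> carrier_mat n n" "vec_space.rank n R \<le> card M + card N"
      and eq: "\<And>i j. i < n \<Longrightarrow> j < n \<Longrightarrow> circ n \<phi> p i j + R $$ (i, j) =
       (if j < i then \<Sum>r\<in>M. v r * r ^ (i - j) else if i < j then \<Sum>r\<in>N. w r * r ^ (j - i) else fc u 0)"
    proof (rule exponential_sum_circ_plus_low_rank[OF assms(1) M(1) N(1), of n v w "fc u 0"])
      show "norm r < 1" if "r \<in> M" for r using M(3)[OF that] by blast
      show "norm r < 1" if "r \<in> N" for r using N(3)[OF that] by blast
    qed (rule that; assumption)
    have "norm (fc u (int i - int j) - circ n \<phi> p i j - R $$ (i, j)) \<le> \<eta>" if ij: "i < n" "j < n" for i j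
    proof -
      consider "j < i" | "i < j" | "i = j" by linarith
      then have "norm (fc u (int i - int j) - (circ n \<phi> p i j + R $$ (i, j))) \<le> \<eta>"
      proof cases
        case 1
        then have "int i - int j = int (i - j)" by simp
        then show ?thesis unfolding eq[OF ij] using v[of "i - j"] 1 by simp
      next
        case 2
        then have "int i - int j = - int (j - i)" by simp
        then show ?thesis unfolding eq[OF ij] using w[of "j - i"] 2 by simp
      next
        case 3
        then show ?thesis unfolding eq[OF ij] using \<eta> by simp
      qed
      then show ?thesis by (simp only: diff_diff_add)
    qed
    moreover have "real (vec_space.rank n R) \<le> (B + B') * (1 + ln (1 / \<eta>))\<^sup>2"
    proof -
      have "real (vec_space.rank n R) \<le> real S + real S'" using R(2) M(2) N(2) by linarith
      then show ?thesis using S(1) S'(1) by (simp add: distrib_right)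
    qed
    ultimately show ?thesis using R(1) by blast
  qed
  then show thesis using that[of "B + B'"] B(1) B'(1) by simp
qed

theorem theorem5p8:
  fixes \<phi> :: complex and f :: "complex \<Rightarrow> complex"
  assumes "norm \<phi> = 1" and "f \<in> log_sing_circle"
  shows "\<exists>(a::real) (b::real) (c::real) (d::real) (K::real) (K'::real).
    \<forall>\<epsilon>::real. \<epsilon> > 0 \<longrightarrow> (\<forall>n::nat. n \<ge> 1 \<longrightarrow>
      (\<exists>P \<in> phi_circulants n \<phi>. \<exists>Q \<in> phi_circulants n \<phi>.
       \<exists>R \<in> carrier_mat n n. \<exists>R' \<in> carrier_mat n n.
         chebyshev_norm (toeplitz n f - P - R) \<le> \<epsilon> * chebyshev_norm (toeplitz n f) \<and>
         \<epsilon> * chebyshev_norm (toeplitz n f) \<le> K * \<epsilon> \<and>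
         chebyshev_norm (toeplitz n (\<lambda>z. of_real (Re (f z))) - Q - R')
           \<le> \<epsilon> * chebyshev_norm (toeplitz n (\<lambda>z. of_real (Re (f z)))) \<and>
         \<epsilon> * chebyshev_norm (toeplitz n (\<lambda>z. of_real (Re (f z)))) \<le> K' * \<epsilon> \<and>
         vec_space.rank n R' \<le> 2 * vec_space.rank n R \<and>
         real (2 * vec_space.rank n R)
           \<le> 2 * ln (1 / \<epsilon>) * (a + b * ln (1 / \<epsilon>) + c * ln (real n)) + d))"
proof -
  define u where "u = (\<lambda>t. f (cis t))"
  define a where "a = fc u"
  define a' where "a' = fc (\<lambda>t. of_real (Re (u t)))"
  define T where "T = (\<lambda>n. toeplitz_mat n a)"
  define T' where "T' = (\<lambda>n. toeplitz_mat n a')"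
  have T: "toeplitz n f = T n" "toeplitz n (\<lambda>z. of_real (Re (f z))) = T' n" for n
    by (simp_all add: T_def T'_def toeplitz_eq a_def a'_def u_def)
  have Tc: "T n \<in> carrier_mat n n" "T' n \<in> carrier_mat n n" for n
    by (simp_all add: T_def T'_def toeplitz_mat_def)
  have u: "log_symbol u" unfolding u_def using assms(2) by (rule log_symbol_log_sing_circle)
  then have int: "integrable circle_measure u" by (simp add: log_symbol_def)
  then have int': "integrable circle_measure (\<lambda>t. complex_of_real (Re (u t)))"
    by (intro integrable_of_real integrable_Re)
  have a': "a' k = (a k + cnj (a (- k))) / 2" for k
    unfolding a_def a'_def using int by (rule fc_Re)
  define K where "K = (LINT t|circle_measure. norm (u t)) / (2 * pi)"
  define K' where "K' = (LINT t|circle_measure. norm (complex_of_real (Re (u t)))) / (2 * pi)"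
  have TK: "chebyshev_norm (T n) \<le> K" "chebyshev_norm (T' n) \<le> K'" if "n \<ge> 1" for n
    unfolding chebyshev_norm_le_iff[OF Tc(1) that] chebyshev_norm_le_iff[OF Tc(2) that]
    using norm_fc_le[OF int] norm_fc_le[OF int']
    by (simp_all add: T_def T'_def toeplitz_mat_def a_def a'_def K_def K'_def)
  obtain B where B: "B \<ge> 0"
    "\<And>\<eta> n. 0 < \<eta> \<Longrightarrow> \<eta> < 1 \<Longrightarrow> \<exists>p R. R \<in> carrier_mat n n \<and>
       real (vec_space.rank n R) \<le> B * (1 + ln (1 / \<eta>))\<^sup>2 \<and>
       (\<forall>i<n. \<forall>j<n. norm (a (int i - int j) - circ n \<phi> p i j - R $$ (i, j)) \<le> \<eta>)"
    unfolding a_def using toeplitz_circulant_low_rank_approx[OF assms(1) u] by blast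
  obtain \<delta>1 where \<delta>1: "0 < \<delta>1" "\<delta>1 \<le> 1"
    "\<And>n. n \<ge> 1 \<Longrightarrow> (\<forall>i<n. \<forall>j<n. a (int i - int j) = 0) \<or> \<delta>1 \<le> chebyshev_norm (T n)"
    unfolding T_def using toeplitz_mat_chebyshev_gap by blast
  obtain \<delta>2 where \<delta>2: "0 < \<delta>2" "\<delta>2 \<le> 1"
    "\<And>n. n \<ge> 1 \<Longrightarrow> (\<forall>i<n. \<forall>j<n. a' (int i - int j) = 0) \<or> \<delta>2 \<le> chebyshev_norm (T' n)"
    unfolding T'_def using toeplitz_mat_chebyshev_gap by blast
  define \<delta> where "\<delta> = min \<delta>1 \<delta>2"
  have \<delta>: "0 < \<delta>" "\<delta> \<le> 1" "\<delta> \<le> \<delta>1" "\<delta> \<le> \<delta>2" using \<delta>1 \<delta>2 by (auto simp: \<delta>_def)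
  define \<beta> where "\<beta> = 1 + ln (1 / \<delta>)"
  have \<beta>: "\<beta> \<ge> 1" using \<delta> by (simp add: \<beta>_def)
  \<comment> \<open>With \<open>L = ln (1 / \<epsilon>) \<ge> 0\<close>, the factor \<beta> absorbs
    the passage from \<epsilon> to \<open>\<epsilon> * \<delta>\<close> and the 2 comes from
    \<open>(1 + L)\<^sup>2 \<le> 2 * L\<^sup>2 + 2\<close>; the rank is at most
    \<open>C * L\<^sup>2 + C\<close>.\<close>
  define C where "C = 2 * B * \<beta>\<^sup>2"
  have C: "C \<ge> 0" using B(1) by (simp add: C_def)
  have zero: "0\<^sub>m n n \<in> phi_circulants n \<phi>" for n
  proof -
    have "Matrix.mat n n (\<lambda>(i, j). circ n \<phi> (\<lambda>_. 0) i j) = 0\<^sub>m n n" by (auto simp: circ_def)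
    then show ?thesis using circ_in_phi_circulants[of n \<phi> "\<lambda>_. 0"] by simp
  qed
  have rank0: "vec_space.rank n (0\<^sub>m n n :: complex mat) = 0" for n by (rule vec_space.rank_0I)
  have minus0: "A - 0\<^sub>m n n - 0\<^sub>m n n = A" if "A \<in> carrier_mat n n" for A :: "complex mat" and n
    using that by auto
  have cheb0: "0 \<le> chebyshev_norm A" if "A \<in> carrier_mat n n" "n \<ge> 1" for A n
    by (rule order_trans[OF norm_ge_zero norm_entry_le_chebyshev_norm[OF that(1), of 0 0]]) (use that(2) in auto)
  have "\<exists>P \<in> phi_circulants n \<phi>. \<exists>Q \<in> phi_circulants n \<phi>. \<exists>R \<in> carrier_mat n n. \<exists>R' \<in> carrier_mat n n.
       chebyshev_norm (T n - P - R) \<le> \<epsilon> * chebyshev_norm (T n) \<and>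
       chebyshev_norm (T' n - Q - R') \<le> \<epsilon> * chebyshev_norm (T' n) \<and>
       vec_space.rank n R' \<le> 2 * vec_space.rank n R \<and>
       real (2 * vec_space.rank n R) \<le> 2 * C * (ln (1 / \<epsilon>))\<^sup>2 + 2 * C"
    if \<epsilon>: "\<epsilon> > 0" and n: "n \<ge> 1" for \<epsilon> n
  proof -
    have rhs: "0 \<le> 2 * C * (ln (1 / \<epsilon>))\<^sup>2 + 2 * C" using C by simp
    \<comment> \<open>All four matrices are taken to be zero. This serves \<epsilon> of at least 1,
      where the tolerance is at least the norm itself, and a zero Toeplitz matrix. The logarithm
      enters the rank bound squared, so its sign for large \<epsilon> is harmless.\<close>
    have trivial: ?thesis
      if "chebyshev_norm (T n) \<le> \<epsilon> * chebyshev_norm (T n)" "chebyshev_norm (T' n) \<le> \<epsilon> * chebyshev_norm (T' n)"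
      using that zero[of n] rank0[of n] minus0[OF Tc(1)[of n]] minus0[OF Tc(2)[of n]] rhs
      by (intro bexI[of _ "0\<^sub>m n n"] conjI) simp_all
    consider "\<epsilon> \<ge> 1" | "\<forall>i<n. \<forall>j<n. a (int i - int j) = 0" | "\<epsilon> < 1" "\<delta>1 \<le> chebyshev_norm (T n)"
      using \<delta>1(3)[OF n] by (meson not_le)
    then show ?thesis
    proof cases
      case 1
      then show ?thesis
        using mult_right_mono[OF 1 cheb0[OF Tc(1) n]] mult_right_mono[OF 1 cheb0[OF Tc(2) n]]
        by (intro trivial) simp_all
    next
      case 2
      then have "a' (int i - int j) = 0" if "i < n" "j < n" for i j
        using that by (simp add: a')
      then have "chebyshev_norm (T n) \<le> 0" "chebyshev_norm (T' n) \<le> 0"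
        using 2 chebyshev_norm_le_iff[OF Tc(1) n] chebyshev_norm_le_iff[OF Tc(2) n]
        by (simp_all add: T_def T'_def toeplitz_mat_def)
      then have "chebyshev_norm (T n) = 0" "chebyshev_norm (T' n) = 0"
        using cheb0[OF Tc(1) n] cheb0[OF Tc(2) n] by linarith+
      then show ?thesis by (intro trivial) simp_all
    next
      case 3
      \<comment> \<open>By the choice of \<delta> this is at most \<epsilon> times the norm of
        either Toeplitz matrix, provided that the matrix is not zero.\<close>
      define \<eta> where "\<eta> = \<epsilon> * \<delta>"
      have "\<epsilon> * \<delta> \<le> \<epsilon> * 1" using \<epsilon> \<delta>(2) by (intro mult_left_mono) auto
      then have \<eta>: "0 < \<eta>" "\<eta> < 1"
        unfolding \<eta>_def using \<epsilon> \<delta>(1) 3(1) by (simp, linarith)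
      obtain p R where R: "R \<in> carrier_mat n n"
        and rank: "real (vec_space.rank n R) \<le> B * (1 + ln (1 / \<eta>))\<^sup>2"
        and err: "\<And>i j. i < n \<Longrightarrow> j < n \<Longrightarrow> norm (a (int i - int j) - circ n \<phi> p i j - R $$ (i, j)) \<le> \<eta>"
        using B(2)[OF \<eta>, of n] by auto
      define P where "P = Matrix.mat n n (\<lambda>(i, j). circ n \<phi> p i j)"
      have P: "P \<in> phi_circulants n \<phi>" unfolding P_def by (rule circ_in_phi_circulants)
      have "norm ((T n - P - R) $$ (i, j)) \<le> \<eta>" if ij: "i < n" "j < n" for i j
        using ij R err[OF ij] by (simp add: P_def T_def toeplitz_mat_def)
      then have "chebyshev_norm (T n - P - R) \<le> \<eta>"
        by (subst chebyshev_norm_le_iff[OF minus_carrier_mat[OF R] n]) blast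
      also have "\<eta> \<le> \<epsilon> * chebyshev_norm (T n)"
        unfolding \<eta>_def using \<epsilon> \<delta>(3) 3(2) by (intro mult_left_mono) auto
      finally have errT: "chebyshev_norm (T n - P - R) \<le> \<epsilon> * chebyshev_norm (T n)" .
      have "real (2 * vec_space.rank n R) \<le> 2 * C * (ln (1 / \<epsilon>))\<^sup>2 + 2 * C"
      proof -
        let ?L = "ln (1 / \<epsilon>)"
        have L: "?L \<ge> 0" using \<epsilon> 3(1) by simp
        have l\<delta>: "ln (1 / \<delta>) \<ge> 0" using \<delta> by simp
        have "ln (1 / \<eta>) = ?L + ln (1 / \<delta>)" using \<epsilon> \<delta>(1) by (simp add: \<eta>_def ln_div ln_mult)
        then have "1 + ln (1 / \<eta>) \<le> \<beta> * (1 + ?L)" "0 \<le> 1 + ln (1 / \<eta>)"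
          unfolding \<beta>_def using L l\<delta> mult_nonneg_nonneg[OF l\<delta> L] by (auto simp: algebra_simps)
        then have "(1 + ln (1 / \<eta>))\<^sup>2 \<le> (\<beta> * (1 + ?L))\<^sup>2" by (rule power_mono)
        also have "\<dots> = \<beta>\<^sup>2 * (1 + ?L)\<^sup>2" by (rule power_mult_distrib)
        also have "\<dots> \<le> \<beta>\<^sup>2 * (2 * ?L\<^sup>2 + 2)"
        proof (rule mult_left_mono)
          have "0 \<le> (?L - 1)\<^sup>2" by simp
          then show "(1 + ?L)\<^sup>2 \<le> 2 * ?L\<^sup>2 + 2" by (simp add: power2_eq_square algebra_simps)
        qed simp
        finally have "B * (1 + ln (1 / \<eta>))\<^sup>2 \<le> B * (\<beta>\<^sup>2 * (2 * ?L\<^sup>2 + 2))"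
          using B(1) by (rule mult_left_mono)
        then have "2 * (B * (1 + ln (1 / \<eta>))\<^sup>2) \<le> 2 * C * ?L\<^sup>2 + 2 * C"
          by (simp add: C_def algebra_simps)
        then show ?thesis using rank by simp
      qed
      note rankR = this
      \<comment> \<open>The matrix for the real part may vanish although that of \<open>f\<close>
        does not. Its relative tolerance is then 0, so that \<open>Q\<close> and \<open>R'\<close>
        are taken to be zero; otherwise they are the Hermitian parts of \<open>P\<close> and
        \<open>R\<close>.\<close>
      show ?thesis
      proof (cases "\<forall>i<n. \<forall>j<n. a' (int i - int j) = 0")
        case True
        then have "chebyshev_norm (T' n) \<le> 0"
          using chebyshev_norm_le_iff[OF Tc(2) n] by (simp add: T'_def toeplitz_mat_def)
        then have "chebyshev_norm (T' n) = 0" using cheb0[OF Tc(2) n] by linarith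
        then have "chebyshev_norm (T' n - 0\<^sub>m n n - 0\<^sub>m n n) \<le> \<epsilon> * chebyshev_norm (T' n)"
          using minus0[OF Tc(2)] by simp
        note errT' = this
        show ?thesis
        proof (rule bexI[OF _ P], rule bexI[OF _ zero], rule bexI[OF _ R], rule bexI[OF _ zero_carrier_mat], intro conjI)
          show "vec_space.rank n (0\<^sub>m n n :: complex mat) \<le> 2 * vec_space.rank n R" by (simp add: rank0)
        qed fact+
      next
        case False
        define R' where "R' = Matrix.mat n n (\<lambda>(i, j). (R $$ (i, j) + cnj (R $$ (j, i))) / 2)"
        define Q where "Q = Matrix.mat n n (\<lambda>(i, j). (circ n \<phi> p i j + cnj (circ n \<phi> p j i)) / 2)"
        have R': "R' \<in> carrier_mat n n" by (simp add: R'_def)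
        have rank': "vec_space.rank n R' \<le> 2 * vec_space.rank n R"
          unfolding R'_def using R by (rule rank_hermitian_part_le)
        have "Q = Matrix.mat n n (\<lambda>(i, j). circ n \<phi>
            (\<lambda>d. (p d + (if d = 0 then cnj (p 0) else cnj \<phi> * cnj (p (n - d)))) / 2) i j)"
          unfolding Q_def using circ_hermitian_part[OF assms(1)] by (intro cong_mat) simp_all
        then have Q: "Q \<in> phi_circulants n \<phi>" by (simp only: circ_in_phi_circulants)
        have "norm ((T' n - Q - R') $$ (i, j)) \<le> \<eta>" if ij: "i < n" "j < n" for i j
        proof -
          let ?e = "\<lambda>i j. a (int i - int j) - circ n \<phi> p i j - R $$ (i, j)"
          have "(T' n - Q - R') $$ (i, j) = (?e i j + cnj (?e j i)) / 2"
            using ij by (simp add: T'_def toeplitz_mat_def Q_def R'_def a' diff_divide_distrib add_divide_distrib)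
          also have "norm \<dots> \<le> (norm (?e i j) + norm (?e j i)) / 2"
            using norm_triangle_ineq[of "?e i j" "cnj (?e j i)"] by (simp only: norm_divide complex_mod_cnj) simp
          also have "\<dots> \<le> \<eta>" using err[OF ij] err[OF ij(2,1)] by simp
          finally show ?thesis .
        qed
        then have "chebyshev_norm (T' n - Q - R') \<le> \<eta>"
          using R' by (subst chebyshev_norm_le_iff[OF minus_carrier_mat[OF R'] n]) blast
        also have "\<eta> \<le> \<epsilon> * chebyshev_norm (T' n)"
          unfolding \<eta>_def using \<epsilon> \<delta>(4) \<delta>2(3)[OF n] False by (intro mult_left_mono) auto
        finally have errT': "chebyshev_norm (T' n - Q - R') \<le> \<epsilon> * chebyshev_norm (T' n)" .
        show ?thesis
        proof (rule bexI[OF _ P], rule bexI[OF _ Q], rule bexI[OF _ R], rule bexI[OF _ R'], intro conjI)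
        qed fact+
      qed
    qed
  qed
  note approx = this
  show ?thesis
  \<comment> \<open>The rank bound is free of \<open>n\<close> and has no linear term in the
    logarithm, so \<open>a\<close> and \<open>c\<close> are 0.\<close>
  proof (rule exI[of _ 0], rule exI[of _ C], rule exI[of _ 0], rule exI[of _ "2 * C"], rule exI[of _ K],
      rule exI[of _ K'], intro allI impI)
    fix \<epsilon> :: real and n :: nat assume \<epsilon>: "\<epsilon> > 0" and n: "n \<ge> 1"
    have K: "\<epsilon> * chebyshev_norm (T n) \<le> K * \<epsilon>" "\<epsilon> * chebyshev_norm (T' n) \<le> K' * \<epsilon>"
      using TK[OF n] \<epsilon> by (simp_all add: mult.commute)
    have rhs: "2 * ln (1 / \<epsilon>) * (0 + C * ln (1 / \<epsilon>) + 0 * ln (real n)) + 2 * C = 2 * C * (ln (1 / \<epsilon>))\<^sup>2 + 2 * C"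
      by (simp add: power2_eq_square)
    obtain P Q R R' where PQ: "P \<in> phi_circulants n \<phi>" "Q \<in> phi_circulants n \<phi>"
        "R \<in> carrier_mat n n" "R' \<in> carrier_mat n n"
      and PQ': "chebyshev_norm (T n - P - R) \<le> \<epsilon> * chebyshev_norm (T n)"
        "chebyshev_norm (T' n - Q - R') \<le> \<epsilon> * chebyshev_norm (T' n)"
        "vec_space.rank n R' \<le> 2 * vec_space.rank n R"
        "real (2 * vec_space.rank n R) \<le> 2 * C * (ln (1 / \<epsilon>))\<^sup>2 + 2 * C"
      using approx[OF \<epsilon> n] by (elim bexE conjE)
    show "\<exists>P \<in> phi_circulants n \<phi>. \<exists>Q \<in> phi_circulants n \<phi>. \<exists>R \<in> carrier_mat n n. \<exists>R' \<in> carrier_mat n n.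
         chebyshev_norm (toeplitz n f - P - R) \<le> \<epsilon> * chebyshev_norm (toeplitz n f) \<and>
         \<epsilon> * chebyshev_norm (toeplitz n f) \<le> K * \<epsilon> \<and>
         chebyshev_norm (toeplitz n (\<lambda>z. of_real (Re (f z))) - Q - R')
           \<le> \<epsilon> * chebyshev_norm (toeplitz n (\<lambda>z. of_real (Re (f z)))) \<and>
         \<epsilon> * chebyshev_norm (toeplitz n (\<lambda>z. of_real (Re (f z)))) \<le> K' * \<epsilon> \<and>
         vec_space.rank n R' \<le> 2 * vec_space.rank n R \<and>
         real (2 * vec_space.rank n R)
           \<le> 2 * ln (1 / \<epsilon>) * (0 + C * ln (1 / \<epsilon>) + 0 * ln (real n)) + 2 * C"
      unfolding T rhs
    proof (rule bexI[OF _ PQ(1)], rule bexI[OF _ PQ(2)], rule bexI[OF _ PQ(3)], rule bexI[OF _ PQ(4)], intro conjI)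
    qed (fact PQ' K)+
  qed
qed

end
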